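(* Let $G$ be an abelian group, let $t\geq 1$ be an integer, and let $A,B\subseteq G$ be finite and nonempty with $|A|\geq t$ and $|B|\geq t$. Then either $$\sum_{i=1}^{t}|A+_iB|\geq t|A|+t|B|-2t^2+1,$$ or else there exist $A'\subseteq A$ and $B'\subseteq B$ such that, writing $l:=|A\setminus A'|+|B\setminus B'|$, letting $H$ be the stabilizer of $A+_tB$, and writing $\rho:=|A'+H|-|A'|+|B'+H|-|B'|$, the subgroup $H$ is nontrivial and $$l\leq t-1,$$ $$A'+_tB'=A'+B'=A+_tB,$$ $$\sum_{i=1}^{t}|A+_iB|\geq t|A|+t|B|-(t-l)(|H|-\rho)-tl\geq t|A|+t|B|-t|H|.$$
   Context: $G$ is written additively. For finite subsets $A,B\subseteq G$: $A+B=\{a+b\mid a\in A,\ b\in B\}$. For $g\in G$, $r_{A,B}(g)=|(g-B)\cap A|$ is the number of representations $g=a+b$ with $a\in A$, $b\in B$. For an integer $i\geq 1$, $A+_iB:=\{g\in G\mid r_{A,B}(g)\geq i\}$ (so $A+_1B=A+B$). The stabilizer of a set $X\subseteq G$ is the subgroup $H(X)=\{x\in G\mid x+X=X\}$. *)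

theory Defs
  imports Complex_Main "HOL-Library.Set_Algebras"
begin

text \<open>
  The sumset \<open>A + B\<close> and the translate \<open>x +o X\<close> are those of Set_Algebras.
\<close>

definition rep_count :: "'a::ab_group_add set \<Rightarrow> 'a set \<Rightarrow> 'a \<Rightarrow> nat" where
  "rep_count A B g = card ((\<lambda>b. g - b) ` B \<inter> A)"

definition popular_sumset :: "'a::ab_group_add set \<Rightarrow> nat \<Rightarrow> 'a set \<Rightarrow> 'a set"
    (\<open>(_ +[_] _)\<close> [66, 0, 66] 65) where
  "A +[i] B = {g. rep_count A B g \<ge> i}"

text \<open>
  The stabilizer of a finite nonempty set is finite, but that of the empty set is the whole
  group, whose \<open>card\<close> is 0 if the group is infinite.
\<close>

definition stabilizer :: "'a::ab_group_add set \<Rightarrow> 'a set" where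
  "stabilizer X = {x. x +o X = X}"

end

theory Submission
  imports Defs
begin

text \<open>
  Put \<open>D = A +[t] B\<close> and let \<open>T\<close> be the number of pairs of \<open>A \<times> B\<close> whose sum misses \<open>D\<close>. Double
  counting turns the sum of the theorem into \<open>t |D| + T\<close>. If it is at most
  \<open>t |A| + t |B| - 2 t\<^sup>2\<close>, delete elements that lie in at least \<open>t\<close> missed pairs; this never
  increases \<open>t |D| + T - t |A| - t |B|\<close>. Call the remaining pair \<open>(A\<^sub>1, B\<^sub>1)\<close>. The heart of the matter
  is that then no missed pair is left: \<open>A\<^sub>1 + B\<^sub>1 \<subseteq> D\<close>. This goes by induction on \<open>|B|\<close> along Dyson's
  transform \<open>(A \<union> B, A \<inter> B)\<close>, whose sumset is periodic by Kneser's theorem; a missed pair of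
  \<open>(A, B)\<close> lives on a coset disjoint from this sumset, and the slices of \<open>A\<close> and \<open>B\<close> on the
  cosets involved are too large for the given deficiency.

  Let \<open>H\<close> be the stabilizer of \<open>A\<^sub>1 + B\<^sub>1\<close> and enlarge to the maximal \<open>A' \<supseteq> A\<^sub>1\<close>, \<open>B' \<supseteq> B\<^sub>1\<close> with the same
  sumset. Each of the \<open>l\<close> elements outside \<open>A'\<close> and \<open>B'\<close> meets a whole coset of \<open>H\<close> outside
  \<open>A' + B'\<close>, hence lies in many missed pairs. Together with Kneser's bound for \<open>|A' + B'|\<close> this
  forces \<open>l < t\<close>, so an element with \<open>t\<close> representations keeps one in \<open>A' + B'\<close>, and \<open>A' + B' = D\<close>.
\<close>

section \<open>Translates, cosets and stabilizers\<close>

lemma mem_stabilizer_iff: "x \<in> stabilizer X \<longleftrightarrow> x +o X = X"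
  by (simp add: stabilizer_def)

lemma mem_elt_set_plus_iff: "x \<in> a +o X \<longleftrightarrow> x - a \<in> (X :: 'a::ab_group_add set)"
  by (force simp: elt_set_plus_def algebra_simps)

lemma card_elt_set_plus: "card (a +o X) = card (X :: 'a::ab_group_add set)"
proof -
  have "a +o X = (+) a ` X"
    by (auto simp: elt_set_plus_def)
  then show ?thesis
    by (simp add: card_image)
qed

lemma finite_elt_set_plus: "finite (a +o X) \<longleftrightarrow> finite (X :: 'a::ab_group_add set)"
proof -
  have "a +o X = (+) a ` X"
    by (auto simp: elt_set_plus_def)
  then show ?thesis
    by (simp add: finite_image_iff)
qed

lemma elt_set_plus_set_plus: "a +o X + Y = a +o (X + Y)" "X + (a +o Y) = a +o (X + Y)"
  for X :: "'a::ab_group_add set"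
  by (simp_all add: set_plus_rearranges)

lemma stabilizer_elt_set_plus: "stabilizer (a +o X) = stabilizer (X :: 'a::ab_group_add set)"
proof -
  have "x +o (a +o X) = a +o X \<longleftrightarrow> x +o X = X" for x
  proof -
    have "x +o (a +o X) = a +o (x +o X)"
      by (simp add: set_plus_rearranges add.commute)
    moreover have "a +o Y = a +o Z \<longleftrightarrow> Y = Z" for Y Z :: "'a set"
    proof
      assume "a +o Y = a +o Z"
      then have "(y - - a \<in> a +o Y) = (y - - a \<in> a +o Z)" for y
        by simp
      then show "Y = Z"
        by (auto simp: mem_elt_set_plus_iff)
    qed simp
    ultimately show ?thesis
      by simp
  qed
  then show ?thesis
    by (simp add: stabilizer_def)
qed

section \<open>Subgroups and periodic sets\<close>

definition is_subgroup :: "'a::ab_group_add set \<Rightarrow> bool" where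
  "is_subgroup H \<longleftrightarrow> 0 \<in> H \<and> (\<forall>x\<in>H. \<forall>y\<in>H. x - y \<in> H)"

lemma is_subgroupD:
  assumes "is_subgroup H"
  shows "0 \<in> H" "x \<in> H \<Longrightarrow> y \<in> H \<Longrightarrow> x - y \<in> H" "x \<in> H \<Longrightarrow> - x \<in> H"
    "x \<in> H \<Longrightarrow> y \<in> H \<Longrightarrow> x + y \<in> H"
proof -
  show z: "0 \<in> H" and d: "x \<in> H \<Longrightarrow> y \<in> H \<Longrightarrow> x - y \<in> H" for x y
    using assms by (auto simp: is_subgroup_def)
  show m: "x \<in> H \<Longrightarrow> - x \<in> H" for x
    using d[OF z] by fastforce
  show "x \<in> H \<Longrightarrow> y \<in> H \<Longrightarrow> x + y \<in> H"
    using d[of x "- y"] m[of y] by simp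
qed

lemma is_subgroup_Int: "is_subgroup H \<Longrightarrow> is_subgroup K \<Longrightarrow> is_subgroup (H \<inter> K)"
  by (auto simp: is_subgroup_def)

lemma subgroup_plus_subgroup:
  assumes "is_subgroup H" "is_subgroup K" "K \<subseteq> H"
  shows "K + H = H"
proof
  show "K + H \<subseteq> H"
    using assms is_subgroupD(4)[of H] by (fastforce simp: set_plus_def)
  show "H \<subseteq> K + H"
    using is_subgroupD(1)[of K] assms(2) by (rule_tac set_zero_plus2) auto
qed

lemma subset_plus_subgroup: "is_subgroup H \<Longrightarrow> X \<subseteq> X + H"
  by (metis add.commute is_subgroupD(1) set_zero_plus2)

lemma plus_subgroup_eqI:
  assumes "is_subgroup H" "\<And>x h. x \<in> X \<Longrightarrow> h \<in> H \<Longrightarrow> x + h \<in> X"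
  shows "X + H = X"
  using assms subset_plus_subgroup[of H X] by (auto simp: set_plus_def)

lemma add_mem_periodic: "X + H = X \<Longrightarrow> x \<in> X \<Longrightarrow> h \<in> H \<Longrightarrow> x + h \<in> X"
  by (metis set_plus_intro)

lemma diff_mem_periodic:
  assumes "is_subgroup H" "X + H = X" "x \<in> X" "y - x \<in> H"
  shows "y \<in> X"
  using add_mem_periodic[OF assms(2,3,4)] by simp

lemma is_subgroup_stabilizer: "is_subgroup (stabilizer X)"
proof -
  have "x - y \<in> stabilizer X" if "x \<in> stabilizer X" "y \<in> stabilizer X" for x y
  proof -
    have x: "z - x \<in> X \<longleftrightarrow> z \<in> X" and y: "z - y \<in> X \<longleftrightarrow> z \<in> X" for z
      using that unfolding mem_stabilizer_iff by (metis mem_elt_set_plus_iff)+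
    have "z \<in> (x - y) +o X \<longleftrightarrow> z \<in> X" for z
      using x[of "z + y"] y[of "z + y"] by (simp add: mem_elt_set_plus_iff algebra_simps)
    then show ?thesis
      by (auto simp: mem_stabilizer_iff)
  qed
  moreover have "0 \<in> stabilizer X"
    by (simp add: mem_stabilizer_iff)
  ultimately show ?thesis
    by (simp add: is_subgroup_def)
qed

lemma plus_stabilizer: "X + stabilizer X = X"
proof (rule plus_subgroup_eqI[OF is_subgroup_stabilizer])
  fix x h assume "x \<in> X" "h \<in> stabilizer X"
  then have "h + x \<in> h +o X" "h +o X = X"
    by (auto simp: mem_stabilizer_iff)
  then show "x + h \<in> X"
    by (simp add: add.commute)
qed

text \<open>A translate has the same cardinality, so for finite sets inclusion forces
  equality.\<close>

lemma mem_stabilizerI: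
  assumes "finite X" "x +o X \<subseteq> X"
  shows "x \<in> stabilizer X"
  unfolding mem_stabilizer_iff
  using assms by (intro card_subset_eq) (auto simp: card_elt_set_plus)

lemma subset_stabilizerI:
  assumes "finite X" "X + H \<subseteq> X"
  shows "H \<subseteq> stabilizer X"
  using assms by (auto intro!: mem_stabilizerI simp: elt_set_plus_def add.commute set_plus_intro subset_iff)

lemma stabilizer_subset_coset:
  assumes "is_subgroup H" "X \<noteq> {}" "X \<subseteq> p +o H"
  shows "stabilizer X \<subseteq> H"
proof
  fix k assume k: "k \<in> stabilizer X"
  obtain x where x: "x \<in> X"
    using assms by auto
  then have "x + k \<in> X"
    using add_mem_periodic[OF plus_stabilizer] k by blast
  then have "x - p \<in> H" "x + k - p \<in> H"
    using assms x by (auto simp: subset_iff mem_elt_set_plus_iff)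
  then show "k \<in> H"
    using is_subgroupD(2)[OF assms(1), of "x + k - p" "x - p"] by simp
qed

lemma stabilizer_subset_translate: "x \<in> X \<Longrightarrow> stabilizer X \<subseteq> (- x) +o X"
  using add_mem_periodic[OF plus_stabilizer, of x X] by (auto simp: mem_elt_set_plus_iff add.commute)

lemma finite_stabilizer: "finite X \<Longrightarrow> X \<noteq> {} \<Longrightarrow> finite (stabilizer X)"
  by (metis all_not_in_conv finite_elt_set_plus finite_subset stabilizer_subset_translate)

lemma card_le_card_set_plus:
  fixes A B :: "'a::ab_group_add set"
  assumes "finite A" "finite B" "B \<noteq> {}"
  shows "card A \<le> card (A + B)"
proof -
  obtain b where "b \<in> B"
    using assms by auto
  then have "b +o A \<subseteq> A + B"
    by (auto simp: elt_set_plus_def add.commute intro: set_plus_intro)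
  then show ?thesis
    using assms by (metis card_elt_set_plus card_mono finite_set_plus)
qed

lemma set_plus_eq_empty_iff: "A + B = {} \<longleftrightarrow> A = {} \<or> B = {}"
  by (auto simp: set_plus_def)

lemma Un_set_plus: "(A \<union> B) + C = (A + C) \<union> (B + C)"
  by (auto simp: set_plus_def)

section \<open>Cosets, and the holes that a set leaves in the cosets it meets\<close>

lemma self_mem_coset: "is_subgroup H \<Longrightarrow> a \<in> a +o H"
  by (simp add: mem_elt_set_plus_iff is_subgroupD)

lemma cosets_disjoint:
  assumes "is_subgroup H" "a - b \<notin> H"
  shows "(a +o H) \<inter> (b +o H) = {}"
proof -
  have False if "x - a \<in> H" "x - b \<in> H" for x
    using is_subgroupD(2)[OF assms(1) that(2,1)] assms(2) by simp
  then show ?thesis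
    by (auto simp: mem_elt_set_plus_iff)
qed

lemma coset_eqI:
  assumes "is_subgroup H" "a - b \<in> H"
  shows "a +o H = b +o H"
proof -
  have "x - a \<in> H \<longleftrightarrow> x - b \<in> H" for x
    using is_subgroupD(2)[OF assms(1) _ assms(2), of "x - b"]
      is_subgroupD(4)[OF assms(1) _ assms(2), of "x - a"] by auto
  then show ?thesis
    by (auto simp: mem_elt_set_plus_iff)
qed

lemma coset_subset_plus:
  assumes "a \<in> A"
  shows "a +o H \<subseteq> A + H"
  using assms by (auto simp: elt_set_plus_def intro: set_plus_intro)

text \<open>\<open>A + H\<close> contains \<open>A\<close> and the whole coset of \<open>a\<close>,
  so the holes of \<open>A\<close> in this coset are among the |A + H| - |A| holes in total.\<close>

lemma coset_holes:
  fixes A H :: "'a::ab_group_add set"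
  assumes "finite A" "finite H" "is_subgroup H" "a \<in> A"
  shows "card H + card A \<le> card (A \<inter> (a +o H)) + card (A + H)"
proof -
  have "card ((a +o H) \<union> A) \<le> card (A + H)"
    using assms coset_subset_plus[OF assms(4), of H] subset_plus_subgroup[OF assms(3), of A]
    by (intro card_mono) (auto simp: finite_set_plus)
  moreover have "card (a +o H) + card A = card ((a +o H) \<union> A) + card ((a +o H) \<inter> A)"
    using assms by (intro card_Un_Int) (auto simp: finite_elt_set_plus)
  ultimately show ?thesis
    by (simp add: card_elt_set_plus Int_commute)
qed

text \<open>As \<open>coset_holes\<close>: the holes in two disjoint cosets share the same
  total.\<close>

lemma coset_holes_two:
  fixes A H :: "'a::ab_group_add set"
  assumes "finite A" "finite H" "is_subgroup H" "a \<in> A" "b \<in> A" "a - b \<notin> H"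
  shows "2 * card H + card A \<le> card (A \<inter> (a +o H)) + card (A \<inter> (b +o H)) + card (A + H)"
proof -
  let ?P = "(a +o H) \<union> (b +o H)"
  note disj = cosets_disjoint[OF assms(3,6)]
  have P: "card ?P = 2 * card H"
    using disj assms(2) by (simp add: card_Un_disjoint finite_elt_set_plus card_elt_set_plus)
  have "card (?P \<union> A) \<le> card (A + H)"
    using assms coset_subset_plus[OF assms(4), of H] coset_subset_plus[OF assms(5), of H]
      subset_plus_subgroup[OF assms(3), of A]
    by (intro card_mono) (auto simp: finite_set_plus)
  moreover have "card ?P + card A = card (?P \<union> A) + card (?P \<inter> A)"
    using assms by (intro card_Un_Int) (auto simp: finite_elt_set_plus)
  moreover have "card (?P \<inter> A) = card (A \<inter> (a +o H)) + card (A \<inter> (b +o H))"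
  proof -
    have "?P \<inter> A = (A \<inter> (a +o H)) \<union> (A \<inter> (b +o H))"
      by auto
    then show ?thesis
      using disj assms(1) by (simp add: card_Un_disjoint disjoint_iff)
  qed
  ultimately show ?thesis
    using P by simp
qed

lemma plus_subgroup_Int_coset:
  assumes "is_subgroup H" "K \<subseteq> H"
  shows "(X + K) \<inter> (a +o H) \<subseteq> (X \<inter> (a +o H)) + K"
proof
  fix z assume "z \<in> (X + K) \<inter> (a +o H)"
  then obtain x k where xk: "x \<in> X" "k \<in> K" "z = x + k" and z: "z - a \<in> H"
    by (auto simp: set_plus_def mem_elt_set_plus_iff)
  then have "x - a \<in> H"
    using is_subgroupD(2)[OF assms(1) z, of k] assms(2) by (auto simp: algebra_simps)
  then show "z \<in> (X \<inter> (a +o H)) + K"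
    using xk by (auto simp: mem_elt_set_plus_iff)
qed

lemma coset_plus_coset:
  assumes "is_subgroup H" "x \<in> a +o H" "y \<in> b +o H"
  shows "x + y \<in> (a + b) +o H"
proof -
  have "(x - a) + (y - b) \<in> H"
    using assms is_subgroupD(4) by (auto simp: mem_elt_set_plus_iff)
  then show ?thesis
    by (simp add: mem_elt_set_plus_iff algebra_simps)
qed

lemma coset_plus_subgroup:
  assumes "is_subgroup H" "K \<subseteq> H" "Y \<subseteq> p +o H"
  shows "Y + K \<subseteq> p +o H"
proof
  fix z assume "z \<in> Y + K"
  then obtain y k where "y \<in> Y" "k \<in> K" "z = y + k"
    by (rule set_plus_elim)
  moreover from this have "y \<in> p +o H" "k \<in> 0 +o H"
    using assms(2,3) by auto
  ultimately show "z \<in> p +o H"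
    using coset_plus_coset[OF assms(1), of y p k 0] by simp
qed

section \<open>Kneser's theorem\<close>

text \<open>By \<open>closed\<close>, a translate of \<open>B\<close> that meets \<open>A\<close>
  lies in \<open>A\<close>. Then \<open>b' - b0\<close> stabilizes \<open>A + B\<close> for all
  \<open>b'\<close> in \<open>B\<close>, so |B| is at most the size of the stabilizer.\<close>

lemma kneser_differences_closed:
  fixes A B :: "'a::ab_group_add set"
  assumes fin: "finite A" "finite B" and ne: "A \<noteq> {}" "B \<noteq> {}"
    and closed: "\<And>a b b'. a \<in> A \<Longrightarrow> b \<in> B \<Longrightarrow> b' \<in> B \<Longrightarrow> b' + (a - b) \<in> A"
  shows "card A + card B \<le> card (A + B) + card (stabilizer (A + B))"
proof -
  obtain b0 where b0: "b0 \<in> B"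
    using ne by auto
  have "(- b0) +o B \<subseteq> stabilizer (A + B)"
  proof (rule subset_stabilizerI)
    show "A + B + ((- b0) +o B) \<subseteq> A + B"
    proof
      fix z assume "z \<in> A + B + ((- b0) +o B)"
      then obtain a b b' where *: "a \<in> A" "b \<in> B" "b' \<in> B" "z = (a + b) + (- b0 + b')"
        by (auto simp: set_plus_def elt_set_plus_def)
      then have "z = (b' + (a - b0)) + b"
        by (simp add: algebra_simps)
      then show "z \<in> A + B"
        using closed[OF \<open>a \<in> A\<close> b0 \<open>b' \<in> B\<close>] \<open>b \<in> B\<close> by (auto intro: set_plus_intro)
    qed
  qed (use fin in \<open>simp add: finite_set_plus\<close>)
  then have "card B \<le> card (stabilizer (A + B))"
    using finite_stabilizer[of "A + B"] fin ne
    by (metis card_elt_set_plus card_mono finite_set_plus set_plus_eq_empty_iff)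
  then show ?thesis
    using card_le_card_set_plus[of A B] fin ne by simp
qed

text \<open>Dyson's transform \<open>(U, I)\<close> keeps the total size, has its sumset inside
  \<open>D\<close>, and \<open>I\<close> is smaller than \<open>B\<close>, so the induction
  hypothesis yields a large periodic subset of \<open>D\<close>. If \<open>D\<close> is not periodic
  under the least subgroup \<open>H\<close> that occurs, Kneser's bound for slices of
  \<open>A\<close> and \<open>B\<close> on cosets of \<open>H\<close> contradicts
  minimality.\<close>

lemma kneser_step:
  fixes A B :: "'a::ab_group_add set"
  assumes fin: "finite A" "finite B" and meet: "A \<inter> B \<noteq> {}" and nsub: "\<not> B \<subseteq> A"
    and IH: "\<And>A' B' :: 'a set. card (A' + B') + card B' < card (A + B) + card B \<Longrightarrow> finite A' \<Longrightarrow> finite B' \<Longrightarrow>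
      A' \<noteq> {} \<Longrightarrow> B' \<noteq> {} \<Longrightarrow> card A' + card B' \<le> card (A' + B') + card (stabilizer (A' + B'))"
  shows "card A + card B \<le> card (A + B) + card (stabilizer (A + B))"
proof -
  define U I D where "U = A \<union> B" and "I = A \<inter> B" and "D = A + B"
  have finUI: "finite U" "finite I" "finite D"
    using fin by (auto simp: U_def I_def D_def finite_set_plus)
  have cUI: "card U + card I = card A + card B"
    using card_Un_Int[OF fin] by (simp add: U_def I_def)
  have neUI: "U \<noteq> {}" "I \<noteq> {}" "A \<noteq> {}" "B \<noteq> {}"
    using meet by (auto simp: U_def I_def)
  have UI_sub: "U + I \<subseteq> D"
    by (auto simp: U_def I_def D_def set_plus_def) (metis add.commute)
  \<comment> \<open>The convergents of DeVos's short proof; one with \<open>H\<close> as small as possible gives the bound.\<close>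
  define conv where "conv C H \<longleftrightarrow> is_subgroup H \<and> finite H \<and> U + I \<subseteq> C \<and> C \<subseteq> D \<and> C + H = C \<and>
      card (U + H) + card I \<le> card C + card H" for C H
  have "conv (U + I) (stabilizer (U + I))"
  proof -
    let ?H = "stabilizer (U + I)"
    have sum: "U + ?H + I = U + I"
      using plus_stabilizer[of "U + I"] by (simp add: ac_simps)
    have finH: "finite ?H"
      using finUI neUI by (intro finite_stabilizer) (auto simp: finite_set_plus set_plus_eq_empty_iff)
    have "card I < card B"
      using nsub fin by (intro psubset_card_mono) (auto simp: I_def)
    moreover have "card (U + I) \<le> card D"
      using UI_sub finUI by (intro card_mono)
    \<comment> \<open>Using \<open>U + ?H\<close> in place of \<open>U\<close> leaves the sumset
      unchanged and gives the periodic size that \<open>conv\<close> asks for.\<close>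
    ultimately have "card (U + ?H) + card I \<le> card (U + ?H + I) + card (stabilizer (U + ?H + I))"
      using finUI neUI finH is_subgroupD(1)[OF is_subgroup_stabilizer, of "U + I"]
      by (intro IH) (auto simp: sum D_def finite_set_plus set_plus_eq_empty_iff)
    then show ?thesis
      using finH UI_sub by (simp add: conv_def sum is_subgroup_stabilizer plus_stabilizer)
  qed
  then obtain C H where conv: "conv C H" and min: "\<And>C' H'. conv C' H' \<Longrightarrow> card H \<le> card H'"
    using ex_has_least_nat[of "\<lambda>(C, H). conv C H" "(U + I, stabilizer (U + I))" "\<lambda>(C, H). card H"]
    by auto
  then have H: "is_subgroup H" "finite H" and C: "U + I \<subseteq> C" "C \<subseteq> D" "C + H = C"
    and cC: "card (U + H) + card I \<le> card C + card H"
    by (auto simp: conv_def)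
  have finC: "finite C"
    using C finUI by (meson finite_subset psubset_imp_subset)
  have cUH: "card U \<le> card (U + H)"
    using H finUI is_subgroupD(1)[OF H(1)] by (intro card_le_card_set_plus) auto
  show ?thesis
  proof (cases "D + H \<subseteq> D")
    case True
    then have "card H \<le> card (stabilizer D)"
      using finUI neUI by (intro card_mono finite_stabilizer subset_stabilizerI)
        (auto simp: D_def set_plus_eq_empty_iff)
    moreover have "card C \<le> card D"
      using C finUI by (intro card_mono)
    ultimately show ?thesis
      using cC cUH cUI by (simp add: D_def)
  next
    case False
    then obtain z where "z \<in> D + H" "z \<notin> D"
      by auto
    moreover from this obtain a b h where ab: "a \<in> A" "b \<in> B" and "h \<in> H" "z = a + b + h"
      unfolding D_def by (elim set_plus_elim) auto
    ultimately have h: "h \<in> H" "a + b + h \<notin> D"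
      by auto
    \<comment> \<open>The coset \<open>P\<close> meets \<open>D\<close> in \<open>a + b\<close> but
      is not filled by it, as \<open>g\<close> is missing.\<close>
    define g where "g = a + b + h"
    define P where "P = (a + b) +o H"
    have gP: "g \<in> P" and gD: "g \<notin> D"
      using h by (auto simp: g_def P_def mem_elt_set_plus_iff)
    have PC: "P \<inter> C = {}"
    proof -
      have False if "x - (a + b) \<in> H" "x \<in> C" for x
      proof -
        have "g - x \<in> H"
          using is_subgroupD(2)[OF H(1) h(1) that(1)] by (simp add: g_def algebra_simps)
        then have "g \<in> C"
          using diff_mem_periodic[OF H(1) C(3) that(2)] by simp
        then show False
          using C gD by auto
      qed
      then show ?thesis
        by (auto simp: P_def mem_elt_set_plus_iff)
    qed
    have Iab: "I \<inter> (a +o H) = {}" "I \<inter> (b +o H) = {}"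
    proof -
      have False if "i \<in> I" "i - a \<in> H \<or> i - b \<in> H" for i
      proof -
        have "a + i \<in> C" "b + i \<in> C"
          using C(1) that(1) ab by (auto simp: U_def intro!: set_plus_intro subsetD[OF C(1)])
        moreover have "a + i \<in> P \<or> b + i \<in> P"
          using that(2) by (auto simp: P_def mem_elt_set_plus_iff algebra_simps)
        ultimately show False
          using PC by auto
      qed
      then show "I \<inter> (a +o H) = {}" "I \<inter> (b +o H) = {}"
        unfolding disjoint_iff mem_elt_set_plus_iff by blast+
    qed
    have cD: "card C + card X \<le> card D" "card (C \<union> X) = card C + card X" if "X \<subseteq> D" "X \<subseteq> P" for X
    proof -
      have "finite X"
        using that finUI by (meson finite_subset psubset_imp_subset)
      then show *: "card (C \<union> X) = card C + card X"
        using finC that PC by (intro card_Un_disjoint) auto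
      have "card (C \<union> X) \<le> card D"
        using that C finUI by (intro card_mono) auto
      with * show "card C + card X \<le> card D"
        by simp
    qed
    \<comment> \<open>For a smaller subgroup \<open>K\<close>, only the size bound can keep
      \<open>C \<union> X\<close> from being a convergent. Its failure is compared with the bound
      \<open>cC\<close>.\<close>
    have nonconv: "card X + card K + card (U + H) < card (U + K) + card H"
      if K: "is_subgroup K" "K \<subset> H" and X: "X \<subseteq> D" "X \<subseteq> P" "X + K = X" for K X
    proof (rule ccontr)
      assume not: "\<not> ?thesis"
      have "finite K"
        using K H by (meson finite_subset psubset_imp_subset)
      have "C \<union> X + K = C \<union> X"
      proof (rule plus_subgroup_eqI[OF K(1)])
        fix x h assume "x \<in> C \<union> X" "h \<in> K"
        then show "x + h \<in> C \<union> X"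
          using add_mem_periodic[OF C(3), of x h] add_mem_periodic[OF X(3), of x h] K(2) by auto
      qed
      then have "conv (C \<union> X) K"
        using K X C \<open>finite K\<close> cD(2)[OF X(1,2)] cC not by (auto simp: conv_def)
      from min[OF this] show False
        using psubset_card_mono[OF H(2) K(2)] by simp
    qed
    \<comment> \<open>If the stabilizer of \<open>X\<close> were all of \<open>H\<close>, then
      \<open>X\<close> would fill \<open>P\<close> and contain \<open>g\<close>.\<close>
    have pair: "X \<subseteq> D" "X \<subseteq> P" "X \<noteq> {}" "K \<subset> H" "card (A' + K) + card (B' + K) \<le> card X + card K"
      if "A' \<subseteq> A" "B' \<subseteq> B" "A' \<subseteq> p +o H" "B' \<subseteq> q +o H" "p + q = a + b" "A' \<noteq> {}" "B' \<noteq> {}"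
        "X = A' + B'" "K = stabilizer X" for A' B' p q X K
    proof -
      show XD: "X \<subseteq> D"
        using that(1,2,8) by (simp add: D_def set_plus_mono2)
      show XP: "X \<subseteq> P"
      proof
        fix z assume "z \<in> X"
        then obtain x y where "x \<in> A'" "y \<in> B'" "z = x + y"
          unfolding \<open>X = A' + B'\<close> by (rule set_plus_elim)
        then show "z \<in> P"
          using coset_plus_coset[OF H(1), of x p y q] that(3-5) by (auto simp: P_def)
      qed
      show Xne: "X \<noteq> {}"
        using that by (simp add: set_plus_eq_empty_iff)
      have "K \<subseteq> H"
        using stabilizer_subset_coset[OF H(1) Xne] XP that by (simp add: P_def)
      moreover have "K \<noteq> H"
      proof
        assume "K = H"
        then have "X + H = X"
          using plus_stabilizer[of X] that by simp
        obtain x where x: "x \<in> X"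
          using Xne by auto
        then have "g - x \<in> H"
          using XP is_subgroupD(2)[OF H(1), of "g - (a + b)" "x - (a + b)"] gP
          by (auto simp: P_def mem_elt_set_plus_iff subset_iff)
        then have "g \<in> X"
          using diff_mem_periodic[OF H(1) \<open>X + H = X\<close> x] by simp
        then show False
          using XD gD by auto
      qed
      ultimately show "K \<subset> H"
        by auto
      have fins: "finite A'" "finite B'" "finite K"
        using finite_subset[OF that(1) fin(1)] finite_subset[OF that(2) fin(2)]
          finite_subset[OF psubset_imp_subset[OF \<open>K \<subset> H\<close>] H(2)] by auto
      have K: "is_subgroup K" "X + K = X"
        using that by (auto simp: is_subgroup_stabilizer plus_stabilizer)
      then have sum: "(A' + K) + (B' + K) = X"
        using that(8) subgroup_plus_subgroup[OF K(1) K(1)] by (metis add.assoc add.left_commute order_refl)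
      have "card (B' + K) \<le> card H"
      proof -
        have "B' + K \<subseteq> q +o H"
          using coset_plus_subgroup \<open>K \<subset> H\<close> that(4) H(1) by blast
        then show ?thesis
          using H(2) by (metis card_elt_set_plus card_mono finite_elt_set_plus)
      qed
      moreover have "card H \<le> card C"
      proof -
        obtain c where "c \<in> C"
          using C neUI by (metis all_not_in_conv set_plus_eq_empty_iff subset_empty)
        then have "c +o H \<subseteq> C"
          using coset_subset_plus[of c C H] C by simp
        then show ?thesis
          using finC by (metis card_elt_set_plus card_mono)
      qed
      moreover have "card B > 0"
        using fin neUI by (simp add: card_gt_0_iff)
      \<comment> \<open>The measure drops: \<open>B' + K\<close> fits into a coset of
        \<open>H\<close>, \<open>C\<close> contains such a coset, and \<open>C\<close> and
        \<open>X\<close> are disjoint parts of \<open>D\<close>.\<close>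
      ultimately have "card ((A' + K) + (B' + K)) + card (B' + K) < card (A + B) + card B"
        using cD(1)[OF XD XP] by (simp add: sum D_def)
      then have "card (A' + K) + card (B' + K) \<le> card ((A' + K) + (B' + K)) + card (stabilizer ((A' + K) + (B' + K)))"
        using fins that is_subgroupD(1)[OF K(1)]
        by (intro IH) (auto simp: finite_set_plus set_plus_eq_empty_iff)
      then show "card (A' + K) + card (B' + K) \<le> card X + card K"
        unfolding sum that(9)[symmetric] .
    qed
    \<comment> \<open>Both \<open>A1 + B1\<close> and \<open>A2 + B2\<close> lie in
      \<open>P\<close>, and together the four slices make up \<open>U\<close> on the cosets of
      \<open>a\<close> and \<open>b\<close>.\<close>
    define A1 B1 A2 B2 where "A1 = A \<inter> (a +o H)" and "B1 = B \<inter> (b +o H)"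
      and "A2 = A \<inter> (b +o H)" and "B2 = B \<inter> (a +o H)"
    define X1 K1 where "X1 = A1 + B1" and "K1 = stabilizer X1"
    have ne1: "A1 \<noteq> {}" "B1 \<noteq> {}"
      using ab self_mem_coset[OF H(1)] by (auto simp: A1_def B1_def)
    note pair1 = pair[of A1 B1 a b X1 K1, OF _ _ _ _ _ ne1 X1_def K1_def]
    have p1: "X1 \<subseteq> D" "X1 \<subseteq> P" "X1 \<noteq> {}" "K1 \<subset> H" "card (A1 + K1) + card (B1 + K1) \<le> card X1 + card K1"
      by (rule pair1; simp add: A1_def B1_def)+
    have K1: "is_subgroup K1" "X1 + K1 = X1"
      by (auto simp: K1_def is_subgroup_stabilizer plus_stabilizer)
    have UKH: "U + K + H = U + H" if "is_subgroup K" "K \<subseteq> H" for K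
      using subgroup_plus_subgroup[OF H(1) that] by (simp add: add.assoc)
    have slice: "card ((U + K) \<inter> (a +o H)) \<le> card (A1 + K) + card (B2 + K)"
      "card ((U + K) \<inter> (b +o H)) \<le> card (A2 + K) + card (B1 + K)"
      "a \<in> U + K" "b \<in> U + K" "finite (U + K)"
      if K: "is_subgroup K" "K \<subseteq> H" for K
    proof -
      have "finite K"
        using K H by (meson finite_subset psubset_imp_subset)
      then show "finite (U + K)"
        using finUI by (simp add: finite_set_plus)
      show "a \<in> U + K" "b \<in> U + K"
        using subset_plus_subgroup[OF K(1), of U] ab by (auto simp: U_def)
      have *: "card ((U + K) \<inter> (p +o H)) \<le> card (A \<inter> (p +o H) + K) + card (B \<inter> (p +o H) + K)" for p
      proof -
        have "(U + K) \<inter> (p +o H) \<subseteq> (A \<inter> (p +o H) + K) \<union> (B \<inter> (p +o H) + K)"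
          using plus_subgroup_Int_coset[OF H(1) K(2), of U p]
          by (simp add: U_def Int_Un_distrib2 Un_set_plus)
        then have "card ((U + K) \<inter> (p +o H)) \<le> card ((A \<inter> (p +o H) + K) \<union> (B \<inter> (p +o H) + K))"
          using fin \<open>finite K\<close> by (intro card_mono) (auto simp: finite_set_plus)
        also have "\<dots> \<le> card (A \<inter> (p +o H) + K) + card (B \<inter> (p +o H) + K)"
          by (rule card_Un_le)
        finally show ?thesis .
      qed
      show "card ((U + K) \<inter> (a +o H)) \<le> card (A1 + K) + card (B2 + K)"
        "card ((U + K) \<inter> (b +o H)) \<le> card (A2 + K) + card (B1 + K)"
        using *[of a] *[of b] by (simp_all add: A1_def B1_def A2_def B2_def)
    qed
    have n1: "card (A1 + K1) + card (B1 + K1) + card (U + H) < card (U + K1) + card H"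
      using nonconv[OF K1(1) p1(4) p1(1,2) K1(2)] p1(5) by simp
    show ?thesis
    proof (cases "a - b \<in> H")
      \<comment> \<open>With a single coset, the holes of \<open>U + K1\<close> in it already
        contradict \<open>n1\<close>.\<close>
      case True
      then have "a +o H = b +o H"
        by (rule coset_eqI[OF H(1)])
      then have "card ((U + K1) \<inter> (a +o H)) \<le> card (A1 + K1) + card (B1 + K1)"
        using slice(1)[OF K1(1)] p1(4) by (auto simp: B1_def B2_def)
      then have False
        using coset_holes[OF slice(5) H(2,1) slice(3), of K1] K1 p1(4) UKH[of K1] n1 by auto
      then show ?thesis ..
    next
      case False
      have two: "2 * card H + card (U + K) \<le> card (A1 + K) + card (B2 + K) + card (A2 + K) + card (B1 + K) + card (U + H)"
        if "is_subgroup K" "K \<subseteq> H" for K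
        using coset_holes_two[OF slice(5) H(2,1) slice(3,4) False, of K] slice(1,2)[OF that] that UKH[OF that]
        by simp
      \<comment> \<open>Each of the two sets fits into a coset of \<open>H\<close>, so neither
        \<open>A2\<close> nor \<open>B2\<close> can be empty.\<close>
      have big: "card H < card (A2 + K1) + card (B2 + K1)"
        using two[OF K1(1) psubset_imp_subset[OF p1(4)]] n1 by simp
      have le: "card (Y + K1) \<le> card H" if "Y \<subseteq> p +o H" for Y p
      proof -
        have "Y + K1 \<subseteq> p +o H"
          using coset_plus_subgroup p1(4) that H(1) by blast
        then show ?thesis
          using H(2) by (metis card_elt_set_plus card_mono finite_elt_set_plus)
      qed
      have ne2: "A2 \<noteq> {}" "B2 \<noteq> {}"
        using big le[of A2 b] le[of B2 a] by (auto simp: A2_def B2_def)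
      define X2 K2 where "X2 = A2 + B2" and "K2 = stabilizer X2"
      note pair2 = pair[of A2 B2 b a X2 K2, OF _ _ _ _ _ ne2 X2_def K2_def]
      have p2: "X2 \<subseteq> D" "X2 \<subseteq> P" "X2 \<noteq> {}" "K2 \<subset> H" "card (A2 + K2) + card (B2 + K2) \<le> card X2 + card K2"
        by (rule pair2; simp add: A2_def B2_def add.commute)+
      have K2: "is_subgroup K2" "X2 + K2 = X2"
        by (auto simp: K2_def is_subgroup_stabilizer plus_stabilizer)
      \<comment> \<open>Neither \<open>X1\<close> nor \<open>X2\<close> meets its own subgroup's coset of \<open>g\<close>, so \<open>X1 \<inter> X2\<close> avoids \<open>g +o (K1 \<union> K2)\<close>;
        this contradicts that \<open>C \<union> X\<close> with the smaller subgroup \<open>M\<close> is not a convergent.\<close>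
      define M X where "M = K1 \<inter> K2" and "X = X1 \<union> X2"
      have M: "is_subgroup M" "M \<subset> H" "M \<subseteq> K1" "M \<subseteq> K2"
        using K1 K2 p1(4) by (auto simp: M_def is_subgroup_Int)
      have finK: "finite K1" "finite K2"
        using finite_subset[OF psubset_imp_subset[OF p1(4)] H(2)]
          finite_subset[OF psubset_imp_subset[OF p2(4)] H(2)] by auto
      have fins: "finite A1" "finite B1" "finite A2" "finite B2" "finite X1" "finite X2"
        using fin by (auto simp: A1_def A2_def B1_def B2_def X1_def X2_def finite_set_plus)
      have "X + M = X"
      proof (rule plus_subgroup_eqI[OF M(1)])
        fix x h assume "x \<in> X" "h \<in> M"
        then show "x + h \<in> X"
          using add_mem_periodic[OF K1(2), of x h] add_mem_periodic[OF K2(2), of x h] M(3,4)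
          by (auto simp: X_def)
      qed
      then have n2: "card X + card M + card (U + H) < card (U + M) + card H"
        using nonconv[OF M(1,2)] p1 p2 by (auto simp: X_def)
      have mono: "card (Y + M) \<le> card (Y + K1)" "card (Y + M) \<le> card (Y + K2)" if "finite Y" for Y
        using card_mono[OF finite_set_plus[OF that finK(1)] set_plus_mono2[OF order_refl M(3)]]
          card_mono[OF finite_set_plus[OF that finK(2)] set_plus_mono2[OF order_refl M(4)]] by auto
      \<comment> \<open>By inclusion-exclusion this says |X1 \<inter> X2| + |K1 \<union> K2| >
        |H|.\<close>
      have upper: "card H + card M + card X < card X1 + card K1 + card X2 + card K2"
        using two[OF M(1) psubset_imp_subset[OF M(2)]] n2 p1(5) p2(5) mono(1)[OF fins(1)] mono(1)[OF fins(2)]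
          mono(2)[OF fins(3)] mono(2)[OF fins(4)] by simp
      have "card X1 + card X2 = card X + card (X1 \<inter> X2)"
        unfolding X_def by (rule card_Un_Int[OF fins(5,6)])
      moreover have "card K1 + card K2 = card (g +o (K1 \<union> K2)) + card M"
        using card_Un_Int[OF finK] by (simp add: M_def card_elt_set_plus)
      moreover have "card (X1 \<inter> X2) + card (g +o (K1 \<union> K2)) \<le> card H"
      proof -
        have "{g} + (K1 \<union> K2) \<subseteq> P"
          unfolding P_def using gP p1(4) p2(4) by (intro coset_plus_subgroup[OF H(1)]) (auto simp: P_def)
        then have "g +o (K1 \<union> K2) \<subseteq> P"
          using coset_subset_plus[of g "{g}" "K1 \<union> K2"] by simp
        moreover have "(X1 \<inter> X2) \<inter> (g +o (K1 \<union> K2)) = {}"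
        proof -
          have "g \<in> X1" if "x \<in> X1" "x - g \<in> K1" for x
            using diff_mem_periodic[OF K1 that(1), of g] is_subgroupD(3)[OF K1(1) that(2)] by simp
          moreover have "g \<in> X2" if "x \<in> X2" "x - g \<in> K2" for x
            using diff_mem_periodic[OF K2 that(1), of g] is_subgroupD(3)[OF K2(1) that(2)] by simp
          ultimately show ?thesis
            using gD p1(1) p2(1) unfolding disjoint_iff mem_elt_set_plus_iff by blast
        qed
        ultimately have "card (X1 \<inter> X2) + card (g +o (K1 \<union> K2)) = card ((X1 \<inter> X2) \<union> (g +o (K1 \<union> K2)))"
          using fins finK by (intro card_Un_disjoint[symmetric]) (auto simp: finite_elt_set_plus)
        also have "\<dots> \<le> card P"
          using \<open>g +o (K1 \<union> K2) \<subseteq> P\<close> p1(2) H(2)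
          by (intro card_mono) (auto simp: P_def finite_elt_set_plus)
        also have "card P = card H"
          by (simp add: P_def card_elt_set_plus)
        finally show ?thesis .
      qed
      ultimately have False
        using upper by simp
      then show ?thesis ..
    qed
  qed
qed

text \<open>Translating \<open>B\<close> changes neither the measure nor the claim. If some
  translate meets \<open>A\<close> without lying in it, \<open>kneser_step\<close> applies;
  otherwise \<open>kneser_differences_closed\<close> does.\<close>

lemma kneser_weak:
  fixes A B :: "'a::ab_group_add set"
  assumes "finite A" "finite B" "A \<noteq> {}" "B \<noteq> {}"
  shows "card A + card B \<le> card (A + B) + card (stabilizer (A + B))"
  using assms
proof (induction "card (A + B) + card B" arbitrary: A B rule: less_induct)
  case less
  show ?case
  proof (cases "\<forall>a\<in>A. \<forall>b\<in>B. \<forall>b'\<in>B. b' + (a - b) \<in> A")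
    case True
    then show ?thesis
      using less.prems by (intro kneser_differences_closed) auto
  next
    case False
    then obtain a b b' where ab: "a \<in> A" "b \<in> B" "b' \<in> B" "b' + (a - b) \<notin> A"
      by auto
    let ?B = "(a - b) +o B"
    have sum: "A + ?B = (a - b) +o (A + B)"
      by (rule elt_set_plus_set_plus)
    have "card A + card ?B \<le> card (A + ?B) + card (stabilizer (A + ?B))"
    proof (rule kneser_step)
      show "A \<inter> ?B \<noteq> {}" "\<not> ?B \<subseteq> A"
        using ab by (force simp: elt_set_plus_def algebra_simps)+
    qed (use less in \<open>auto simp: sum card_elt_set_plus finite_elt_set_plus\<close>)
    then show ?thesis
      by (simp add: sum card_elt_set_plus stabilizer_elt_set_plus)
  qed
qed

text \<open>The weak form for \<open>A + H\<close> and \<open>B + H\<close>, whose sumset is again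
  \<open>A + B\<close>.\<close>

theorem kneser:
  fixes A B :: "'a::ab_group_add set"
  assumes "finite A" "finite B" "A \<noteq> {}" "B \<noteq> {}" "H = stabilizer (A + B)"
  shows "card (A + H) + card (B + H) \<le> card (A + B) + card H"
proof -
  have H: "is_subgroup H" "A + B + H = A + B"
    using assms by (simp_all add: is_subgroup_stabilizer plus_stabilizer)
  have "finite H"
    using assms by (simp add: finite_stabilizer finite_set_plus set_plus_eq_empty_iff)
  have sum: "(A + H) + (B + H) = A + B"
    using H subgroup_plus_subgroup[OF H(1) H(1)] by (metis add.assoc add.left_commute order_refl)
  have "A + H \<noteq> {}" "B + H \<noteq> {}"
    using assms(3,4) is_subgroupD(1)[OF H(1)] by (auto simp: set_plus_eq_empty_iff)
  then show ?thesis
    using kneser_weak[of "A + H" "B + H"] assms(1,2) \<open>finite H\<close>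
    by (simp add: sum finite_set_plus flip: assms(5))
qed

section \<open>Missed pairs\<close>

text \<open>\<open>D\<close> is a parameter because three choices occur: the popular sums, their
  part in one coset, and the complement of a point.\<close>

definition missed :: "'a::ab_group_add set \<Rightarrow> 'a set \<Rightarrow> 'a set \<Rightarrow> ('a \<times> 'a) set" where
  "missed D A B = {(a, b). a \<in> A \<and> b \<in> B \<and> a + b \<notin> D}"

lemma finite_missed: "finite A \<Longrightarrow> finite B \<Longrightarrow> finite (missed D A B)"
  by (rule finite_subset[of _ "A \<times> B"]) (auto simp: missed_def)

lemma missed_mono: "A' \<subseteq> A \<Longrightarrow> B' \<subseteq> B \<Longrightarrow> missed D A' B' \<subseteq> missed D A B"
  by (auto simp: missed_def)

lemma card_missed_commute: "card (missed D B A) = card (missed D A B)"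
proof -
  have "missed D B A = prod.swap ` missed D A B"
    by (force simp: missed_def add.commute)
  then show ?thesis
    by (simp add: card_image)
qed

lemma card_missed_rows:
  assumes "finite A" "finite B"
  shows "card (missed D A B) = (\<Sum>a\<in>A. card {b\<in>B. a + b \<notin> D})"
proof -
  have "missed D A B = Sigma A (\<lambda>a. {b\<in>B. a + b \<notin> D})"
    by (auto simp: missed_def)
  then show ?thesis
    using assms by simp
qed

lemma card_missed_cols:
  assumes "finite A" "finite B"
  shows "card (missed D A B) = (\<Sum>b\<in>B. card {a\<in>A. a + b \<notin> D})"
  using card_missed_rows[OF assms(2,1), of D] by (simp add: card_missed_commute add.commute)

lemma card_missed_remove:
  assumes "finite A" "finite B" "b \<in> B"
  shows "card (missed D A B) = card (missed D A (B - {b})) + card {a\<in>A. a + b \<notin> D}"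
  using assms by (simp add: card_missed_cols sum.remove)

section \<open>Representation counts\<close>

lemma rep_count_eq: "rep_count A B g = card {a\<in>A. g - a \<in> B}"
proof -
  have "(\<lambda>b. g - b) ` B \<inter> A = {a\<in>A. g - a \<in> B}"
    by force
  then show ?thesis
    by (simp add: rep_count_def)
qed

lemma rep_count_eq_card_missed: "rep_count A B g = card (missed (- {g}) A B)"
proof -
  have "missed (- {g}) A B = (\<lambda>a. (a, g - a)) ` {a\<in>A. g - a \<in> B}"
    by (force simp: missed_def)
  then show ?thesis
    by (simp add: rep_count_eq card_image inj_on_def)
qed

lemma rep_count_mono:
  assumes "A' \<subseteq> A" "B' \<subseteq> B" "finite A" "finite B"
  shows "rep_count A' B' g \<le> rep_count A B g"
  unfolding rep_count_eq_card_missed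
  using assms by (intro card_mono finite_missed missed_mono)

lemma sum_rep_count:
  assumes "finite A" "finite B" "finite G"
  shows "(\<Sum>g\<in>G. rep_count A B g) = card {(a, b). a \<in> A \<and> b \<in> B \<and> a + b \<in> G}"
proof -
  have "{(a, b). a \<in> A \<and> b \<in> B \<and> a + b \<in> G} = (\<Union>g\<in>G. missed (- {g}) A B)"
    by (auto simp: missed_def)
  moreover have "card (\<Union>g\<in>G. missed (- {g}) A B) = (\<Sum>g\<in>G. card (missed (- {g}) A B))"
    using assms by (intro card_UN_disjoint) (auto simp: finite_missed, auto simp: missed_def)
  ultimately show ?thesis
    by (simp add: rep_count_eq_card_missed)
qed

text \<open>Pigeonhole: \<open>A\<close> and the reflection \<open>g - B\<close> both lie in the
  coset of \<open>p\<close>.\<close>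

lemma rep_count_coset:
  assumes "is_subgroup H" "finite H" "A \<subseteq> p +o H" "B \<subseteq> q +o H" "g \<in> (p + q) +o H"
  shows "card A + card B \<le> card H + rep_count A B g"
proof -
  let ?B = "(\<lambda>b. g - b) ` B"
  have fin: "finite A" "finite B"
    using assms finite_subset by (metis finite_elt_set_plus)+
  have "?B \<subseteq> p +o H"
  proof
    fix x assume "x \<in> ?B"
    then obtain b where b: "b \<in> B" "x = g - b"
      by auto
    then show "x \<in> p +o H"
      using assms(4,5) is_subgroupD(2)[OF assms(1), of "g - (p + q)" "b - q"]
      by (auto simp: mem_elt_set_plus_iff subset_iff algebra_simps)
  qed
  then have "card (?B \<union> A) \<le> card (p +o H)"
    using assms by (intro card_mono) (auto simp: finite_elt_set_plus)
  moreover have "card ?B + card A = card (?B \<union> A) + card (?B \<inter> A)"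
    using fin by (intro card_Un_Int) auto
  moreover have "card ?B = card B"
    by (intro card_image) (auto simp: inj_on_def)
  ultimately show ?thesis
    by (simp add: rep_count_def card_elt_set_plus)
qed

text \<open>
  With \<open>D = - {g}\<close> the missed pairs are the representations of \<open>g\<close>, so this also bounds \<open>rep_count\<close>.
\<close>

lemma card_missed_dyson:
  assumes "finite A" "finite B"
  shows "card (missed D (A \<union> B) (A \<inter> B)) \<le> card (missed D A B)"
\<comment> \<open>A pair is swapped if its first entry lies outside \<open>A\<close>. Swapped pairs
  can be recognized in the image, since their second entry is outside \<open>A\<close>.\<close>
proof (rule card_inj_on_le[where f = "\<lambda>(x, y). if x \<in> A then (x, y) else (y, x)"])
  show "inj_on (\<lambda>(x, y). if x \<in> A then (x, y) else (y, x)) (missed D (A \<union> B) (A \<inter> B))"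
    by (auto simp: inj_on_def missed_def split: if_splits)
  show "(\<lambda>(x, y). if x \<in> A then (x, y) else (y, x)) ` missed D (A \<union> B) (A \<inter> B) \<subseteq> missed D A B"
    by (auto simp: missed_def add.commute split: if_splits)
qed (use assms in \<open>simp add: finite_missed\<close>)

lemma card_missed_translate: "card (missed (e +o D) A (e +o B)) = card (missed D A B)"
proof -
  have "missed (e +o D) A (e +o B) = (\<lambda>(a, b). (a, e + b)) ` missed D A B"
    by (force simp: missed_def mem_elt_set_plus_iff image_iff algebra_simps)
  moreover have "inj_on (\<lambda>(a, b). (a, e + b)) (missed D A B)"
    by (auto simp: inj_on_def)
  ultimately show ?thesis
    by (simp add: card_image)
qed

text \<open>For each \<open>b\<close> the map \<open>a \<mapsto> a + b\<close> is injective, so at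
  most |D| of the sums land in \<open>D\<close>.\<close>

lemma card_missed_ge:
  assumes "finite A" "finite B" "finite D"
  shows "card B * card A \<le> card B * card D + card (missed D A B)"
proof -
  have "card A \<le> card D + card {a\<in>A. a + b \<notin> D}" for b
  proof -
    have "card {a\<in>A. a + b \<in> D} \<le> card D"
      using assms by (intro card_inj_on_le[where f = "\<lambda>a. a + b"]) (auto simp: inj_on_def)
    moreover have "card A = card {a\<in>A. a + b \<in> D} + card {a\<in>A. a + b \<notin> D}"
      using assms by (subst card_Un_disjoint[symmetric]) (auto intro: arg_cong[where f = card])
    ultimately show ?thesis
      by simp
  qed
  then have "(\<Sum>b\<in>B. card A) \<le> (\<Sum>b\<in>B. card D + card {a\<in>A. a + b \<notin> D})"
    by (intro sum_mono)
  then show ?thesis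
    using assms by (simp add: card_missed_cols sum.distrib)
qed

section \<open>Sparse deficient pairs\<close>

text \<open>For \<open>D = A +[t] B\<close> this is the failure of the first alternative of the
  theorem, by \<open>sum_card_popular_sumset\<close>.\<close>

definition deficient :: "nat \<Rightarrow> 'a::ab_group_add set \<Rightarrow> 'a set \<Rightarrow> 'a set \<Rightarrow> bool" where
  "deficient t D A B \<longleftrightarrow> t * card D + card (missed D A B) + 2 * t\<^sup>2 \<le> t * (card A + card B)"

text \<open>The first two clauses say that no further element can be deleted, the third that
  \<open>D\<close> contains \<open>A +[t] B\<close>.\<close>

definition sparse :: "nat \<Rightarrow> 'a::ab_group_add set \<Rightarrow> 'a set \<Rightarrow> 'a set \<Rightarrow> bool" where
  "sparse t D A B \<longleftrightarrow> (\<forall>a\<in>A. card {b\<in>B. a + b \<notin> D} < t) \<and> (\<forall>b\<in>B. card {a\<in>A. a + b \<notin> D} < t) \<and>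
    (\<forall>g. g \<notin> D \<longrightarrow> rep_count A B g < t)"

lemma deficient_commute: "deficient t D B A \<longleftrightarrow> deficient t D A B"
  by (simp add: deficient_def card_missed_commute add.commute)

text \<open>The deletion lowers the right side by \<open>t\<close> and the number of missed pairs by
  at least \<open>t\<close>.\<close>

lemma deficient_remove:
  assumes "deficient t D A B" "finite A" "finite B" "b \<in> B" "t \<le> card {a\<in>A. a + b \<notin> D}"
  shows "deficient t D A (B - {b})"
proof -
  have "card B = Suc (card (B - {b}))"
    using assms by (metis card_Suc_Diff1)
  then show ?thesis
    using assms card_missed_remove[OF assms(2-4), of D] by (simp add: deficient_def algebra_simps)
qed

text \<open>Inserting \<open>card_missed_ge\<close> into the deficiency gives (t - |B|) (|A| - |D|)
  \<ge> 2 t t - t |B|, but \<open>A\<close> bounds the left side by t t - t |B|. The integers are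
  needed since |A| - |D| may be negative.\<close>

lemma not_deficient_small:
  assumes fin: "finite A" "finite B" "finite D" and "t \<ge> 1" and B: "card B \<le> t"
    and A: "card B = t \<or> card A \<le> card D + t"
  shows "\<not> deficient t D A B"
proof
  assume "deficient t D A B"
  then have "t * card D + card (missed D A B) + 2 * t\<^sup>2 \<le> t * (card A + card B)"
    by (simp add: deficient_def)
  then have "int (t * card D + card (missed D A B) + 2 * t\<^sup>2) \<le> int (t * (card A + card B))"
    by (simp only: of_nat_le_iff)
  moreover have "int (card B * card A) \<le> int (card B * card D + card (missed D A B))"
    using card_missed_ge[OF fin] by (simp only: of_nat_le_iff)
  moreover have "(int t - int (card B)) * (int (card A) - int (card D)) \<le> (int t - int (card B)) * int t"
  proof (cases "card B = t")
    case False
    then show ?thesis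
      using A B by (intro mult_left_mono) auto
  qed simp
  moreover have "int t * int t \<ge> 1"
    using \<open>t \<ge> 1\<close> by (simp add: one_le_mult_iff flip: of_nat_mult)
  ultimately show False
    by (simp add: algebra_simps power2_eq_square)
qed

text \<open>A deficient subpair of least total size is sparse. A deletion never takes a set below
  \<open>t\<close> elements, because by \<open>not_deficient_small\<close> a set of exactly
  \<open>t\<close> elements excludes deficiency.\<close>

lemma sparse_subpair:
  assumes fin: "finite A" "finite B" "finite D" and t: "t \<ge> 1" "t \<le> card A" "t \<le> card B"
    and def: "deficient t D A B" and rep: "\<And>g. g \<notin> D \<Longrightarrow> rep_count A B g < t"
  obtains A' B' where "A' \<subseteq> A" "B' \<subseteq> B" "t \<le> card A'" "t \<le> card B'" "deficient t D A' B'" "sparse t D A' B'"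
proof -
  define good where "good = (\<lambda>(A', B'). A' \<subseteq> A \<and> B' \<subseteq> B \<and> t \<le> card A' \<and> t \<le> card B' \<and> deficient t D A' B')"
  have "good (A, B)"
    using t def by (simp add: good_def)
  then obtain X where "good X" "\<And>Y. good Y \<Longrightarrow> card (fst X) + card (snd X) \<le> card (fst Y) + card (snd Y)"
    using ex_has_least_nat[of good "(A, B)" "\<lambda>Y. card (fst Y) + card (snd Y)"] by auto
  then obtain A' B' where good: "A' \<subseteq> A" "B' \<subseteq> B" "t \<le> card A'" "t \<le> card B'" "deficient t D A' B'"
    and min: "\<And>A'' B''. good (A'', B'') \<Longrightarrow> card A' + card B' \<le> card A'' + card B''"
    by (cases X) (fastforce simp: good_def)
  have fin': "finite A'" "finite B'"
    using good fin finite_subset by auto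
  have "card {a\<in>A'. a + b \<notin> D} < t" if b: "b \<in> B'" for b
  proof (rule ccontr)
    assume "\<not> ?thesis"
    then have "deficient t D A' (B' - {b})"
      using good fin' b by (intro deficient_remove) auto
    moreover have "card B' \<noteq> t"
      using not_deficient_small[OF fin' fin(3) t(1)] good by auto
    moreover have "card B' = Suc (card (B' - {b}))"
      using fin' b by (metis card_Suc_Diff1)
    ultimately have "good (A', B' - {b})"
      using good by (auto simp: good_def)
    from min[OF this] show False
      using \<open>card B' = Suc (card (B' - {b}))\<close> by simp
  qed
  moreover have "card {b\<in>B'. a + b \<notin> D} < t" if a: "a \<in> A'" for a
  proof (rule ccontr)
    assume "\<not> ?thesis"
    then have "deficient t D B' (A' - {a})"
      using good fin' a by (intro deficient_remove) (auto simp: add.commute deficient_commute)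
    moreover have "card A' \<noteq> t"
      using not_deficient_small[OF fin'(2,1) fin(3) t(1)] good by (auto simp: deficient_commute)
    moreover have "card A' = Suc (card (A' - {a}))"
      using fin' a by (metis card_Suc_Diff1)
    ultimately have "good (A' - {a}, B')"
      using good by (auto simp: good_def deficient_commute)
    from min[OF this] show False
      using \<open>card A' = Suc (card (A' - {a}))\<close> by simp
  qed
  moreover have "rep_count A' B' g < t" if "g \<notin> D" for g
    using rep[OF that] rep_count_mono[OF good(1,2) fin(1,2), of g] by simp
  ultimately have "sparse t D A' B'"
    by (simp add: sparse_def)
  then show ?thesis
    using that good by blast
qed

text \<open>All sums of \<open>x\<close> with the coset of \<open>y\<close> avoid \<open>C\<close>.
  At most |D - C| of them fall into \<open>D\<close>, and the holes of \<open>Y\<close> bound how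
  many elements the coset lacks.\<close>

lemma coset_outside:
  assumes H: "is_subgroup H" "finite H" "C + H = C" and fin: "finite Y" "finite D"
    and y: "y \<in> Y" "x + y \<notin> C"
  shows "card H + card Y \<le> card (Y + H) + card (D - C) + card {b\<in>Y. x + b \<notin> D}"
proof -
  let ?Y = "Y \<inter> (y +o H)"
  have out: "x + b \<notin> C" if "b \<in> ?Y" for b
    using that y(2) diff_mem_periodic[OF H(1,3), of "x + b" "x + y"] is_subgroupD(3)[OF H(1), of "b - y"]
    by (auto simp: mem_elt_set_plus_iff)
  have "card {b\<in>?Y. x + b \<in> D} \<le> card (D - C)"
    using fin out by (intro card_inj_on_le[where f = "\<lambda>b. x + b"]) (auto simp: inj_on_def)
  moreover have "card {b\<in>?Y. x + b \<notin> D} \<le> card {b\<in>Y. x + b \<notin> D}"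
    using fin by (intro card_mono) auto
  moreover have "card ?Y = card {b\<in>?Y. x + b \<in> D} + card {b\<in>?Y. x + b \<notin> D}"
    using fin by (subst card_Un_disjoint[symmetric]) (auto intro: arg_cong[where f = card])
  ultimately show ?thesis
    using coset_holes[OF fin(1) H(2,1) y(1)] by simp
qed

text \<open>Kneser's bound against the deficiency divided by \<open>t\<close>. Together with
  \<open>coset_outside\<close> it turns one sum outside \<open>A + B\<close> into
  \<open>2 * t\<close> missed pairs with a common entry.\<close>

lemma kneser_holes:
  assumes fin: "finite A" "finite B" "finite D" and ne: "A \<noteq> {}" "B \<noteq> {}"
    and sub: "A + B \<subseteq> D" and t: "t \<ge> 1" and D: "t * card D + 2 * t\<^sup>2 \<le> t * (card A + card B)"
    and H: "H = stabilizer (A + B)"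
  shows "card (A + H) + card (B + H) + card (D - (A + B)) + 2 * t \<le> card A + card B + card H"
proof -
  have "t * (card D + 2 * t) \<le> t * (card A + card B)"
    using D by (simp add: algebra_simps power2_eq_square)
  then have "card D + 2 * t \<le> card A + card B"
    using t by simp
  moreover have "card D = card (A + B) + card (D - (A + B))"
    using fin sub by (metis card_Diff_subset card_mono finite_set_plus le_add_diff_inverse)
  ultimately show ?thesis
    using kneser[OF fin(1,2) ne H] by simp
qed

text \<open>The induction hypothesis handles the transform after deletions, and its sumset
  \<open>C\<close> turns out to be all of \<open>U + I\<close>. A missed sum then lies in a coset
  \<open>P\<close> off \<open>C\<close>, where the induction hypothesis for \<open>A1\<close>,
  \<open>B1\<close> and a count of representations in \<open>A2\<close>, \<open>B2\<close>
  contradict the deficiency.\<close>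

lemma sparse_deficient_step:
  fixes A B D :: "'a::ab_group_add set"
  assumes fin: "finite A" "finite B" "finite D" and t: "t \<ge> 1"
    and sp: "sparse t D A B" and df: "deficient t D A B"
    and meet: "t \<le> card (A \<inter> B)" and nsub: "\<not> B \<subseteq> A"
    and IH: "\<And>A' B' D' :: 'a set. card B' < card B \<Longrightarrow> finite A' \<Longrightarrow> finite B' \<Longrightarrow> finite D' \<Longrightarrow>
      sparse t D' A' B' \<Longrightarrow> deficient t D' A' B' \<Longrightarrow> A' + B' \<subseteq> D'"
  shows "A + B \<subseteq> D"
proof (rule ccontr)
  assume notsub: "\<not> A + B \<subseteq> D"
  define U I where "U = A \<union> B" and "I = A \<inter> B"
  have finUI: "finite U" "finite I"
    using fin by (auto simp: U_def I_def)
  have cUI: "card U + card I = card A + card B"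
    using card_Un_Int[OF fin(1,2)] by (simp add: U_def I_def)
  have degA: "card {b\<in>B. x + b \<notin> D} < t" if "x \<in> A" for x
    using sp that by (simp add: sparse_def)
  have degB: "card {a\<in>A. x + a \<notin> D} < t" if "x \<in> B" for x
    using sp that by (simp add: sparse_def add.commute[of x])
  have df': "t * card D + card (missed D A B) + 2 * t\<^sup>2 \<le> t * (card U + card I)"
    using df by (simp add: deficient_def cUI)
  have "card I < card B"
    using fin nsub by (intro psubset_card_mono) (auto simp: I_def)
  obtain U' I' where sub: "U' \<subseteq> U" "I' \<subseteq> I" and t': "t \<le> card U'" "t \<le> card I'"
    and sd': "deficient t D U' I'" "sparse t D U' I'"
  proof (rule sparse_subpair[OF finUI fin(3) t])
    show "t \<le> card I"
      using meet by (simp add: I_def)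
    also have "card I \<le> card U"
      using finUI by (intro card_mono) (auto simp: I_def U_def)
    finally show "t \<le> card U" .
    show "deficient t D U I"
      using df' card_missed_dyson[OF fin(1,2), of D] by (simp add: deficient_def U_def I_def)
    show "rep_count U I g < t" if "g \<notin> D" for g
      using sp that card_missed_dyson[OF fin(1,2), of "- {g}"]
      by (auto simp: sparse_def U_def I_def rep_count_eq_card_missed intro: le_less_trans)
  qed
  have fin': "finite U'" "finite I'"
    using sub finUI finite_subset by auto
  have ne': "U' \<noteq> {}" "I' \<noteq> {}" "U \<noteq> {}" "I \<noteq> {}"
    using t t' sub by auto
  have le': "card U' \<le> card U" "card I' \<le> card I"
    using sub finUI by (auto intro: card_mono)
  define C H where "C = U' + I'" and "H = stabilizer C"
  have CD: "C \<subseteq> D"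
    unfolding C_def using IH[OF _ fin' fin(3) sd'(2,1)] le' \<open>card I < card B\<close> by simp
  have H: "is_subgroup H" "C + H = C"
    by (simp_all add: H_def is_subgroup_stabilizer plus_stabilizer)
  have finH: "finite H"
    using fin' ne' by (simp add: H_def C_def finite_stabilizer finite_set_plus set_plus_eq_empty_iff)
  have card_plus_H: "card X \<le> card (X + H)" if "finite X" for X
    using that finH is_subgroupD(1)[OF H(1)] by (intro card_le_card_set_plus) auto
  have bound': "t * card D + 2 * t\<^sup>2 \<le> t * (card U' + card I')"
    using sd' by (simp add: deficient_def)
  \<comment> \<open>A sum outside \<open>C\<close> lies in a coset of \<open>H\<close> outside \<open>C\<close>, which by the smallness of \<open>D - C\<close> costs \<open>2 * t\<close>
    missed pairs with one common element; the sparseness of \<open>(A, B)\<close> excludes this.\<close>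
  have UI': "U + I' = C"
  proof
    show "C \<subseteq> U + I'"
      unfolding C_def using sub by (intro set_plus_mono2) auto
    show "U + I' \<subseteq> C"
    proof (rule ccontr)
      assume "\<not> U + I' \<subseteq> C"
      then obtain x i where xi: "x \<in> U" "i \<in> I'" "x + i \<notin> C"
        by (metis set_plus_elim subsetI)
      have "card H + card I' \<le> card (I' + H) + card (D - C) + card {b\<in>I'. x + b \<notin> D}"
        using H finH fin fin' xi by (intro coset_outside)
      moreover have "card (U' + H) + card (I' + H) + card (D - C) + 2 * t \<le> card U' + card I' + card H"
        unfolding C_def using CD C_def H_def fin fin' ne' t bound' by (intro kneser_holes) auto
      ultimately have "2 * t \<le> card {b\<in>I'. x + b \<notin> D}"
        using card_plus_H[OF fin'(1)] by simp
      moreover have "card {b\<in>I'. x + b \<notin> D} \<le> card {b\<in>B. x + b \<notin> D}"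
        "card {b\<in>I'. x + b \<notin> D} \<le> card {b\<in>A. x + b \<notin> D}"
        using fin sub by (auto simp: I_def intro!: card_mono)
      ultimately show False
        using degA[of x] degB[of x] xi(1) by (auto simp: U_def)
    qed
  qed
  \<comment> \<open>An element of \<open>I\<close> is in both \<open>A\<close> and \<open>B\<close>,
    so it has fewer than \<open>t\<close> missed partners in each; hence the threshold
    \<open>2 * t\<close>.\<close>
  have UI: "U + I = C"
  proof
    show "C \<subseteq> U + I"
      unfolding UI'[symmetric] using sub by (intro set_plus_mono2) auto
    show "U + I \<subseteq> C"
    proof (rule ccontr)
      assume "\<not> U + I \<subseteq> C"
      then obtain u i where ui: "u \<in> U" "i \<in> I" "i + u \<notin> C"
        by (metis add.commute set_plus_elim subsetI)
      have "card H + card U \<le> card (U + H) + card (D - C) + card {b\<in>U. i + b \<notin> D}"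
        using H finH fin finUI ui by (intro coset_outside)
      moreover have "t * card D + 2 * t\<^sup>2 \<le> t * (card U + card I')"
        using bound' le' by (meson add_le_mono1 mult_le_mono2 order_trans)
      then have "card (U + H) + card (I' + H) + card (D - C) + 2 * t \<le> card U + card I' + card H"
        unfolding UI'[symmetric] using CD UI' H_def fin fin' finUI ne' t by (intro kneser_holes) auto
      ultimately have "2 * t \<le> card {b\<in>U. i + b \<notin> D}"
        using card_plus_H[OF fin'(2)] by simp
      also have "\<dots> = card ({b\<in>B. i + b \<notin> D} \<union> {a\<in>A. i + a \<notin> D})"
        by (rule arg_cong[where f = card]) (auto simp: U_def)
      also have "\<dots> \<le> card {b\<in>B. i + b \<notin> D} + card {a\<in>A. i + a \<notin> D}"
        by (rule card_Un_le)
      finally show False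
        using degA[of i] degB[of i] ui(2) by (auto simp: I_def)
    qed
  qed
  have finC: "finite C"
    using CD fin finite_subset by auto
  \<comment> \<open>Kneser's bound for \<open>(U, I)\<close>, multiplied by \<open>t\<close> and
    inserted into the deficiency of \<open>(A, B)\<close>.\<close>
  have key: "t * card (U + H) + t * card (D - C) + card (missed D A B) + 2 * t\<^sup>2 \<le> t * card U + t * card H"
  proof -
    have "card (U + H) + card (I + H) \<le> card C + card H"
      using kneser[OF finUI ne'(3,4), of H] by (simp add: UI H_def)
    then have "t * (card (U + H) + card I) \<le> t * (card C + card H)"
      using card_plus_H[OF finUI(2)] by (intro mult_le_mono2) simp
    moreover have "card D = card C + card (D - C)"
      using CD finC fin by (metis card_Diff_subset card_mono le_add_diff_inverse)
    ultimately show ?thesis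
      using df' by (simp add: algebra_simps)
  qed
  obtain a b where ab: "a \<in> A" "b \<in> B" "a + b \<notin> D"
    using notsub by (metis set_plus_elim subsetI)
  define P where "P = (a + b) +o H"
  have PC: "P \<inter> C = {}"
  proof -
    have "a + b \<in> C" if "x \<in> C" "x - (a + b) \<in> H" for x
      using diff_mem_periodic[OF H that(1), of "a + b"] is_subgroupD(3)[OF H(1) that(2)] by simp
    then show ?thesis
      using ab(3) CD unfolding P_def disjoint_iff mem_elt_set_plus_iff by blast
  qed
  \<comment> \<open>Otherwise \<open>P\<close> would meet \<open>U + I = C\<close>. Hence the slices
    below are disjoint on each coset, and \<open>B1\<close> is a proper subset of
    \<open>B\<close>.\<close>
  have Iab: "I \<inter> (a +o H) = {}" "I \<inter> (b +o H) = {}"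
  proof -
    have False if "i \<in> I" "i - a \<in> H \<or> i - b \<in> H" for i
    proof -
      have "a + i \<in> C" "b + i \<in> C"
        using that(1) ab by (auto simp: U_def UI[symmetric])
      moreover have "a + i \<in> P \<or> b + i \<in> P"
        using that(2) by (auto simp: P_def mem_elt_set_plus_iff algebra_simps)
      ultimately show False
        using PC by auto
    qed
    then show "I \<inter> (a +o H) = {}" "I \<inter> (b +o H) = {}"
      unfolding disjoint_iff mem_elt_set_plus_iff by blast+
  qed
  define dP where "dP = card (D \<inter> P)"
  have dP: "t * dP \<le> t * card (D - C)"
    unfolding dP_def using PC fin by (intro mult_le_mono2 card_mono) auto
  define A1 B1 A2 B2 where "A1 = A \<inter> (a +o H)" and "B1 = B \<inter> (b +o H)"
    and "A2 = A \<inter> (b +o H)" and "B2 = B \<inter> (a +o H)"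
  have fins: "finite A1" "finite B1" "finite A2" "finite B2"
    using fin by (auto simp: A1_def A2_def B1_def B2_def)
  have abU: "a \<in> U" "b \<in> U"
    using ab by (auto simp: U_def)
  have "A1 \<inter> B2 = {}" "A2 \<inter> B1 = {}"
    using Iab by (auto simp: A1_def A2_def B1_def B2_def I_def)
  moreover have "U \<inter> (a +o H) = A1 \<union> B2" "U \<inter> (b +o H) = A2 \<union> B1"
    by (auto simp: A1_def A2_def B1_def B2_def U_def)
  ultimately have slices: "card (U \<inter> (a +o H)) = card A1 + card B2"
    "card (U \<inter> (b +o H)) = card A2 + card B1"
    using fins by (auto simp: card_Un_disjoint)
  have P1: "x + y \<in> P" if "x \<in> A1" "y \<in> B1" for x y
    using that coset_plus_coset[OF H(1), of x a y b] by (auto simp: P_def A1_def B1_def)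
  have missed1: "missed (D \<inter> P) A1 B1 = missed D A1 B1"
    using P1 by (auto simp: missed_def)
  \<comment> \<open>Otherwise \<open>(A1, B1)\<close> would be deficient and sparse for
    \<open>D \<inter> P\<close>, and the induction hypothesis would put \<open>a + b\<close> into
    \<open>D\<close>.\<close>
  have bound1: "t * (card A1 + card B1) < t * dP + card (missed D A1 B1) + 2 * t\<^sup>2"
  proof (rule ccontr)
    assume "\<not> ?thesis"
    then have "deficient t (D \<inter> P) A1 B1"
      by (simp add: deficient_def dP_def missed1)
    moreover have "sparse t (D \<inter> P) A1 B1"
    proof -
      have "card {y\<in>B1. x + y \<notin> D \<inter> P} < t" if "x \<in> A1" for x
      proof -
        have "card {y\<in>B1. x + y \<notin> D \<inter> P} \<le> card {y\<in>B. x + y \<notin> D}"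
          using fin P1[OF that] by (intro card_mono) (auto simp: B1_def)
        also have "\<dots> < t"
          using that by (intro degA) (auto simp: A1_def)
        finally show ?thesis .
      qed
      moreover have "card {x\<in>A1. x + y \<notin> D \<inter> P} < t" if "y \<in> B1" for y
      proof -
        have "card {x\<in>A1. x + y \<notin> D \<inter> P} \<le> card {x\<in>A. y + x \<notin> D}"
          using fin P1[OF _ that] by (intro card_mono) (auto simp: A1_def add.commute)
        also have "\<dots> < t"
          using that by (intro degB) (auto simp: B1_def)
        finally show ?thesis .
      qed
      moreover have "rep_count A1 B1 g < t" if "g \<notin> D \<inter> P" for g
      proof (cases "g \<in> P")
        case True
        then have "rep_count A B g < t"
          using that sp by (auto simp: sparse_def)
        then show ?thesis
          using rep_count_mono[of A1 A B1 B g] fin by (auto simp: A1_def B1_def)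
      next
        case False
        then have "missed (- {g}) A1 B1 = {}"
          using P1 by (auto simp: missed_def)
        then show ?thesis
          using t by (simp add: rep_count_eq_card_missed)
      qed
      ultimately show ?thesis
        by (simp add: sparse_def)
    qed
    moreover have "card B1 < card B"
      using Iab ne' fin by (intro psubset_card_mono) (auto simp: B1_def I_def)
    ultimately have "A1 + B1 \<subseteq> D \<inter> P"
      using fins fin by (intro IH) auto
    moreover have "a + b \<in> A1 + B1"
      using ab self_mem_coset[OF H(1)] by (intro set_plus_intro) (auto simp: A1_def B1_def)
    ultimately show False
      using ab by auto
  qed
  show False
  proof (cases "a - b \<in> H")
    case True
    then have "a +o H = b +o H"
      by (rule coset_eqI[OF H(1)])
    then have "B2 = B1"
      by (simp add: B1_def B2_def)
    have "t * (card H + card U) \<le> t * (card A1 + card B1 + card (U + H))"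
      using coset_holes[OF finUI(1) finH H(1) abU(1)] slices(1) \<open>B2 = B1\<close> by (intro mult_le_mono2) simp
    moreover have "card (missed D A1 B1) \<le> card (missed D A B)"
      using fin by (intro card_mono missed_mono finite_missed) (auto simp: A1_def B1_def)
    ultimately show False
      using bound1 key dP unfolding distrib_left by linarith
  next
    case False
    note disj = cosets_disjoint[OF H(1) False]
    define x2 where "x2 = card A2 + card B2"
    have "t * (card H + card H + card U) \<le> t * (card A1 + card B1 + x2 + card (U + H))"
      using coset_holes_two[OF finUI(1) finH H(1) abU False] slices
      by (intro mult_le_mono2) (simp add: x2_def)
    moreover have "card (missed D A1 B1) + card (missed D A2 B2) \<le> card (missed D A B)"
    proof -
      have "card (missed D A1 B1) + card (missed D A2 B2) = card (missed D A1 B1 \<union> missed D A2 B2)"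
        using disj fins
        by (intro card_Un_disjoint[symmetric] finite_missed) (auto simp: missed_def A1_def A2_def)
      also have "\<dots> \<le> card (missed D A B)"
        using fin by (intro card_mono finite_missed)
          (auto simp: missed_def A1_def A2_def B1_def B2_def)
      finally show ?thesis .
    qed
    ultimately have upper: "t * card H + card (missed D A2 B2) < t * x2"
      using bound1 key dP unfolding distrib_left by linarith
    \<comment> \<open>Each of the at least \<open>2 * t\<close> points of \<open>P - D\<close> has
      \<open>x2 - card H\<close> representations in the second pair of slices, all of them missed:
      twice as many as \<open>upper\<close> allows.\<close>
    have "card (P - D) * (x2 - card H) \<le> card (missed D A2 B2)"
    proof -
      have "card (P - D) * (x2 - card H) = (\<Sum>g\<in>P - D. x2 - card H)"
        by simp
      also have "\<dots> \<le> (\<Sum>g\<in>P - D. rep_count A2 B2 g)"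
      proof (rule sum_mono)
        fix g assume "g \<in> P - D"
        then have "card A2 + card B2 \<le> card H + rep_count A2 B2 g"
          by (intro rep_count_coset[OF H(1) finH]) (auto simp: A2_def B2_def P_def add.commute)
        then show "x2 - card H \<le> rep_count A2 B2 g"
          by (simp add: x2_def)
      qed
      also have "\<dots> = card {(x, y). x \<in> A2 \<and> y \<in> B2 \<and> x + y \<in> P - D}"
        using fins finH by (intro sum_rep_count) (auto simp: P_def finite_elt_set_plus)
      also have "\<dots> \<le> card (missed D A2 B2)"
        using fins by (intro card_mono finite_missed) (auto simp: missed_def)
      finally show ?thesis .
    qed
    moreover have "2 * t \<le> card (P - D)"
    proof -
      have "t * card U \<le> t * card (U + H)"
        by (rule mult_le_mono2[OF card_plus_H[OF finUI(1)]])
      then have "t * (dP + t + t) \<le> t * card H"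
        using key dP unfolding distrib_left power2_eq_square by linarith
      then have "dP + 2 * t \<le> card P"
        using t by (simp add: P_def card_elt_set_plus)
      moreover have "card P = dP + card (P - D)"
        unfolding dP_def using finH fin
        by (subst card_Un_disjoint[symmetric]) (auto simp: P_def finite_elt_set_plus intro: arg_cong[where f = card])
      ultimately show ?thesis
        by simp
    qed
    ultimately have "2 * t * (x2 - card H) \<le> card (missed D A2 B2)"
      by (meson mult_le_mono1 order_trans)
    moreover have "card H < x2"
      using upper by (metis add_lessD1 mult_less_cancel1)
    then have "t * x2 = t * card H + t * (x2 - card H)"
      by (simp flip: distrib_left)
    ultimately show False
      using upper by simp
  qed
qed

text \<open>Inclusion-exclusion inside \<open>D\<close> for the translates \<open>b +o A\<close> and
  \<open>a +o B\<close>, whose intersection is a translate of the last set.\<close>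

lemma card_add_le_popular_difference:
  fixes A B D :: "'a::ab_group_add set"
  assumes fin: "finite A" "finite B" "finite D"
  shows "card A + card B \<le> card D + card {b'\<in>B. a + b' \<notin> D} + card {a'\<in>A. a' + b \<notin> D} +
    card (A \<inter> ((a - b) +o B))"
proof -
  let ?X = "b +o A" and ?Y = "a +o B"
  have finXY: "finite ?X" "finite ?Y"
    using fin by (simp_all add: finite_elt_set_plus)
  have "card ((?X \<inter> D) \<union> (?Y \<inter> D)) \<le> card D"
    using fin by (intro card_mono) auto
  moreover have "card (?X \<inter> D) + card (?Y \<inter> D) = card ((?X \<inter> D) \<union> (?Y \<inter> D)) + card ((?X \<inter> D) \<inter> (?Y \<inter> D))"
    using finXY by (intro card_Un_Int) auto
  moreover have "card ((?X \<inter> D) \<inter> (?Y \<inter> D)) \<le> card (?X \<inter> ?Y)"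
    using finXY by (intro card_mono) auto
  moreover have "?X \<inter> ?Y = b +o (A \<inter> ((a - b) +o B))"
    by (auto simp: mem_elt_set_plus_iff)
  moreover have "card A = card (?X \<inter> D) + card (?X - D)" "card B = card (?Y \<inter> D) + card (?Y - D)"
    using card_Int_Diff[of ?X D] card_Int_Diff[of ?Y D] finXY by (simp_all add: card_elt_set_plus)
  moreover have "?X - D = b +o {a'\<in>A. a' + b \<notin> D}" "?Y - D = a +o {b'\<in>B. a + b' \<notin> D}"
    by (auto simp: mem_elt_set_plus_iff)
  ultimately show ?thesis
    by (simp add: card_elt_set_plus)
qed

lemma sparse_deficient_translate:
  "sparse t (e +o D) A (e +o B) \<longleftrightarrow> sparse t D A B"
  "deficient t (e +o D) A (e +o B) \<longleftrightarrow> deficient t D A B"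
proof -
  have 1: "card {b\<in>e +o B. a + b \<notin> e +o D} = card {b\<in>B. a + b \<notin> D}" for a
  proof -
    have "{b\<in>e +o B. a + b \<notin> e +o D} = e +o {b\<in>B. a + b \<notin> D}"
      by (auto simp: mem_elt_set_plus_iff algebra_simps)
    then show ?thesis
      by (simp add: card_elt_set_plus)
  qed
  have 2: "(\<forall>b\<in>e +o B. card {a\<in>A. a + b \<notin> e +o D} < t) \<longleftrightarrow> (\<forall>b\<in>B. card {a\<in>A. a + b \<notin> D} < t)"
  proof -
    have "{a\<in>A. a + (e + b) \<notin> e +o D} = {a\<in>A. a + b \<notin> D}" for b
      by (simp add: mem_elt_set_plus_iff algebra_simps)
    moreover have "(\<forall>b\<in>e +o B. Q b) \<longleftrightarrow> (\<forall>b\<in>B. Q (e + b))" for Q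
      by (auto simp: elt_set_plus_def)
    ultimately show ?thesis
      by simp
  qed
  have 3: "rep_count A (e +o B) g = rep_count A B (g - e)" for g
    by (simp add: rep_count_eq mem_elt_set_plus_iff algebra_simps)
  have 4: "(\<forall>g. g \<notin> e +o D \<longrightarrow> rep_count A B (g - e) < t) \<longleftrightarrow> (\<forall>g. g \<notin> D \<longrightarrow> rep_count A B g < t)"
    by (metis add_diff_cancel mem_elt_set_plus_iff)
  show "sparse t (e +o D) A (e +o B) \<longleftrightarrow> sparse t D A B"
    by (simp add: sparse_def 1 2 3 4)
  show "deficient t (e +o D) A (e +o B) \<longleftrightarrow> deficient t D A B"
    by (simp add: deficient_def card_missed_translate card_elt_set_plus)
qed

text \<open>
  If no translate of \<open>B\<close> admits a proper transform, then \<open>B\<close> lies in one coset of the stabilizer of \<open>A\<close>,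
  and every sum has \<open>|B| \<ge> t\<close> representations.
\<close>

theorem sparse_deficient_imp_subset:
  fixes A B D :: "'a::ab_group_add set"
  assumes "t \<ge> 1" "finite A" "finite B" "finite D" "sparse t D A B" "deficient t D A B"
  shows "A + B \<subseteq> D"
  using assms(2-)
proof (induction "card B" arbitrary: A B D rule: less_induct)
  case less
  note fin = less.prems(1-3) and sp = less.prems(4) and df = less.prems(5)
  show ?case
  proof (rule ccontr)
    assume notsub: "\<not> A + B \<subseteq> D"
    then obtain a1 b1 where ab1: "a1 \<in> A" "b1 \<in> B" "a1 + b1 \<notin> D"
      by (metis set_plus_elim subsetI)
    define deg where "deg b = card {a\<in>A. a + b \<notin> D}" for b
    have degB: "deg b < t" if "b \<in> B" for b
      using sp that by (simp add: sparse_def deg_def)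
    have "t < card B"
    proof (rule ccontr)
      assume "\<not> t < card B"
      moreover have "card A \<le> card D + t"
      proof -
        have "card A = card {a\<in>A. a + b1 \<in> D} + deg b1"
          unfolding deg_def using fin
          by (subst card_Un_disjoint[symmetric]) (auto intro: arg_cong[where f = card])
        moreover have "card {a\<in>A. a + b1 \<in> D} \<le> card D"
          using fin by (intro card_inj_on_le[where f = "\<lambda>a. a + b1"]) (auto simp: inj_on_def)
        ultimately show ?thesis
          using degB[OF ab1(2)] by simp
      qed
      ultimately show False
        using not_deficient_small[OF fin assms(1)] df by auto
    qed
    \<comment> \<open>The column with the fewest missed pairs is chosen; since |B| > t, at least
      \<open>t\<close> times its degree is paid for by all missed pairs together.\<close>
    obtain b0 where b0: "b0 \<in> B" "\<And>b. b \<in> B \<Longrightarrow> deg b0 \<le> deg b"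
      using ex_min_if_finite[of "deg ` B"] fin ab1(2) by (metis (no_types, lifting) empty_iff finite_imageI image_iff image_is_empty not_le)
    have "t * deg b0 \<le> card (missed D A B)"
    proof -
      have "t * deg b0 \<le> card B * deg b0"
        using \<open>t < card B\<close> by simp
      also have "\<dots> \<le> (\<Sum>b\<in>B. deg b)"
        using sum_mono[of B "\<lambda>_. deg b0" deg] b0 by simp
      also have "\<dots> = card (missed D A B)"
        using fin by (simp add: card_missed_cols deg_def)
      finally show ?thesis .
    qed
    \<comment> \<open>Of the surplus \<open>2 * t\<^sup>2\<close>, the row of \<open>a\<close> uses
      less than \<open>t * t\<close>, and the column of \<open>b0\<close> is covered by the missed
      pairs.\<close>
    have popular: "t \<le> card (A \<inter> ((a - b0) +o B))" if "a \<in> A" for a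
    proof -
      have "card {b\<in>B. a + b \<notin> D} < t"
        using sp that by (simp add: sparse_def)
      then have "card A + card B \<le> card D + t + deg b0 + card (A \<inter> ((a - b0) +o B))"
        using card_add_le_popular_difference[OF fin, of a b0] by (simp add: deg_def)
      then have "t * (card A + card B) \<le> t * (card D + t + deg b0 + card (A \<inter> ((a - b0) +o B)))"
        by (rule mult_le_mono2)
      then have "t * t \<le> t * card (A \<inter> ((a - b0) +o B))"
        using df \<open>t * deg b0 \<le> card (missed D A B)\<close>
        unfolding deficient_def power2_eq_square distrib_left by linarith
      then show ?thesis
        using assms(1) by simp
    qed
    show False
    proof (cases "\<forall>a\<in>A. (a - b0) +o B \<subseteq> A")
      case True
      then have closed: "a + (b - b0) \<in> A" if "a \<in> A" "b \<in> B" for a b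
        using that by (force simp: elt_set_plus_def algebra_simps)
      \<comment> \<open>Translation by \<open>b - b0\<close> permutes the finite set
        \<open>A\<close>, so \<open>a1\<close> has a preimage; adding \<open>b1 - b0\<close> to it
        stays in \<open>A\<close>. Thus every \<open>b\<close> gives a representation of
        \<open>a1 + b1\<close>.\<close>
      have "{b\<in>B. a1 + b1 - b \<in> A} = B"
      proof -
        have "a1 + b1 - b \<in> A" if b: "b \<in> B" for b
        proof -
          have "(\<lambda>a. a + (b - b0)) ` A = A"
            using fin closed[OF _ b] by (intro endo_inj_surj) (auto simp: inj_on_def)
          then obtain a where "a \<in> A" "a1 = a + (b - b0)"
            using ab1(1) by blast
          then have eq: "a1 + b1 - b = a + (b1 - b0)"
            by (simp add: algebra_simps)
          show ?thesis
            unfolding eq by (rule closed[OF \<open>a \<in> A\<close> ab1(2)])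
        qed
        then show ?thesis
          by auto
      qed
      moreover have "rep_count A B (a1 + b1) = card {b\<in>B. a1 + b1 - b \<in> A}"
        by (metis card_missed_commute rep_count_eq rep_count_eq_card_missed)
      moreover have "rep_count A B (a1 + b1) < t"
        using sp ab1 by (simp add: sparse_def)
      ultimately show False
        using \<open>t < card B\<close> by simp
    next
      case False
      then obtain a where a: "a \<in> A" "\<not> (a - b0) +o B \<subseteq> A"
        by auto
      let ?e = "a - b0"
      have "A + (?e +o B) \<subseteq> ?e +o D"
      proof (rule sparse_deficient_step[of _ _ _ t])
        show "finite A" "finite (?e +o B)" "finite (?e +o D)"
          using fin by (simp_all add: finite_elt_set_plus)
        show "sparse t (?e +o D) A (?e +o B)" "deficient t (?e +o D) A (?e +o B)"
          using sp df by (simp_all add: sparse_deficient_translate)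
        show "t \<le> card (A \<inter> (?e +o B))"
          by (rule popular[OF a(1)])
        fix A' B' D' :: "'a set"
        assume "card B' < card (?e +o B)" "finite A'" "finite B'" "finite D'"
          "sparse t D' A' B'" "deficient t D' A' B'"
        then show "A' + B' \<subseteq> D'"
          using less.hyps[of B' A' D'] by (simp add: card_elt_set_plus)
      qed (use assms(1) a(2) in auto)
      then have "?e + (a1 + b1) \<in> ?e +o D"
        using set_plus_intro2[OF set_plus_intro[OF ab1(1,2)], of ?e] by (auto simp: elt_set_plus_set_plus(2))
      then show False
        using ab1 by (simp add: mem_elt_set_plus_iff)
    qed
  qed
qed

section \<open>Popular sums\<close>

text \<open>For \<open>i = 0\<close> the popular sumset would be the whole group; from 1 on it is
  finite for finite sets.\<close>

lemma popular_sumset_eq: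
  assumes "i \<ge> 1"
  shows "A +[i] B = {g\<in>A + B. i \<le> rep_count A B g}"
proof -
  have "g \<in> A + B" if "i \<le> rep_count A B g" for g
  proof -
    have "(\<lambda>b. g - b) ` B \<inter> A \<noteq> {}"
      using that assms by (auto simp: rep_count_def)
    then obtain b where "b \<in> B" "g - b \<in> A"
      by auto
    then show ?thesis
      using set_plus_intro[of "g - b" A b B] by simp
  qed
  then show ?thesis
    by (auto simp: popular_sumset_def)
qed

text \<open>A sum \<open>g\<close> is counted min(t, r(g)) times: \<open>t\<close> times in
  \<open>D\<close>, and once per missed pair outside.\<close>

lemma sum_card_popular_sumset:
  assumes "t \<ge> 1" "finite A" "finite B"
  shows "(\<Sum>i=1..t. card (A +[i] B)) = t * card (A +[t] B) + card (missed (A +[t] B) A B)"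
proof -
  define S D where "S = A + B" and "D = A +[t] B"
  have fin: "finite S" and DS: "D \<subseteq> S"
    using assms by (auto simp: S_def D_def finite_set_plus popular_sumset_eq)
  have mem_D: "g \<in> D \<longleftrightarrow> t \<le> rep_count A B g" for g
    by (simp add: D_def popular_sumset_def)
  have "(\<Sum>i=1..t. card (A +[i] B)) = (\<Sum>i=1..t. card {g\<in>S. i \<le> rep_count A B g})"
    by (intro sum.cong) (auto simp: S_def popular_sumset_eq)
  also have "\<dots> = (\<Sum>g\<in>S. min t (rep_count A B g))"
  proof (rule sum_multicount_gen)
    show "\<forall>g\<in>S. card {i\<in>{1..t}. i \<le> rep_count A B g} = min t (rep_count A B g)"
    proof
      fix g
      have "{i\<in>{1..t}. i \<le> rep_count A B g} = {1..min t (rep_count A B g)}"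
        by auto
      then show "card {i\<in>{1..t}. i \<le> rep_count A B g} = min t (rep_count A B g)"
        by simp
    qed
  qed (use fin in auto)
  also have "\<dots> = (\<Sum>g\<in>S - D. rep_count A B g) + (\<Sum>g\<in>D. t)"
    using sum.subset_diff[OF DS fin, of "\<lambda>g. min t (rep_count A B g)"] by (simp add: mem_D)
  also have "(\<Sum>g\<in>S - D. rep_count A B g) = card {(a, b). a \<in> A \<and> b \<in> B \<and> a + b \<in> S - D}"
    using assms fin by (intro sum_rep_count) auto
  also have "{(a, b). a \<in> A \<and> b \<in> B \<and> a + b \<in> S - D} = missed D A B"
    by (auto simp: missed_def S_def)
  finally show ?thesis
    by (simp add: D_def)
qed

section \<open>From the sparse subpair back to the given sets\<close>

theorem theorem1p1:
  fixes A B :: "'a::ab_group_add set" and t :: nat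
  assumes "t \<ge> 1"
    and "finite A" and "A \<noteq> {}" and "finite B" and "B \<noteq> {}"
    and "card A \<ge> t" and "card B \<ge> t"
  shows "(\<Sum>i=1..t. int (card (A +[i] B)))
            \<ge> int t * int (card A) + int t * int (card B) - 2 * (int t)\<^sup>2 + 1
       \<or> (\<exists>A' B'. A' \<subseteq> A \<and> B' \<subseteq> B \<and>
            (let l = int (card (A - A')) + int (card (B - B'));
                 H = stabilizer (A +[t] B);
                 \<rho> = int (card (A' + H)) - int (card A') + int (card (B' + H)) - int (card B')
             in H \<noteq> {0} \<and>
                l \<le> int t - 1 \<and>
                A' +[t] B' = A' + B' \<and> A' + B' = A +[t] B \<and>
                (\<Sum>i=1..t. int (card (A +[i] B)))
                  \<ge> int t * int (card A) + int t * int (card B)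
                      - (int t - l) * (int (card H) - \<rho>) - int t * l \<and>
                int t * int (card A) + int t * int (card B)
                      - (int t - l) * (int (card H) - \<rho>) - int t * l
                  \<ge> int t * int (card A) + int t * int (card B) - int t * int (card H)))"
proof (rule disj_commute[THEN iffD1], rule disjCI)
  note t = \<open>t \<ge> 1\<close> and fin = \<open>finite A\<close> \<open>finite B\<close>
  define D where "D = A +[t] B"
  have finD: "finite D"
    using t fin by (simp add: D_def popular_sumset_eq finite_set_plus)
  have rep: "g \<notin> D \<longleftrightarrow> rep_count A B g < t" for g
    by (auto simp: D_def popular_sumset_def)
  have S: "(\<Sum>i=1..t. int (card (A +[i] B))) = int t * int (card D) + int (card (missed D A B))"
    using sum_card_popular_sumset[OF t fin] by (simp add: D_def flip: of_nat_sum of_nat_mult of_nat_add)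
  assume "\<not> (\<Sum>i=1..t. int (card (A +[i] B)))
            \<ge> int t * int (card A) + int t * int (card B) - 2 * (int t)\<^sup>2 + 1"
  \<comment> \<open>Over the integers the negation absorbs the \<open>+ 1\<close>.\<close>
  then have S_less: "int t * int (card D) + int (card (missed D A B)) + 2 * (int t)\<^sup>2
      \<le> int t * int (card A) + int t * int (card B)"
    unfolding S by simp
  then have "int (t * card D + card (missed D A B) + 2 * t\<^sup>2) \<le> int (t * (card A + card B))"
    by (simp add: algebra_simps)
  then have "deficient t D A B"
    unfolding deficient_def by (simp only: of_nat_le_iff)
  then obtain A1 B1 where sub1: "A1 \<subseteq> A" "B1 \<subseteq> B" and card1: "t \<le> card A1" "t \<le> card B1"
    and df1: "deficient t D A1 B1" and sp1: "sparse t D A1 B1"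
    using sparse_subpair[OF fin finD t assms(6,7)] rep by blast
  define C H where "C = A1 + B1" and "H = stabilizer C"
  have fin1: "finite A1" "finite B1"
    using sub1 fin finite_subset by auto
  have CD: "C \<subseteq> D"
    unfolding C_def using sparse_deficient_imp_subset[OF t fin1 finD sp1 df1] .
  \<comment> \<open>\<open>B'\<close> is taken relative to \<open>A'\<close>, not \<open>A1\<close>,
    so that \<open>A' + B'\<close> stays in \<open>C\<close>. An element outside \<open>A'\<close>
    leaves \<open>C\<close> already with some element of \<open>B1\<close>.\<close>
  define A' B' where "A' = {a\<in>A. \<forall>b\<in>B1. a + b \<in> C}" and "B' = {b\<in>B. \<forall>a\<in>A'. a + b \<in> C}"
  have sub': "A' \<subseteq> A" "B' \<subseteq> B"
    by (auto simp: A'_def B'_def)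
  have sub1': "A1 \<subseteq> A'" "B1 \<subseteq> B'"
    using sub1 by (auto simp: A'_def B'_def C_def)
  have C_eq: "A' + B' = C"
  proof
    show "A' + B' \<subseteq> C"
      by (auto simp: B'_def elim: set_plus_elim)
    show "C \<subseteq> A' + B'"
      unfolding C_def using sub1' by (rule set_plus_mono2)
  qed
  have fin': "finite A'" "finite B'"
    using sub' fin finite_subset by auto
  have card1': "card A1 \<le> card A'" "card B1 \<le> card B'"
    using sub1' fin' by (auto intro: card_mono)
  then have ne': "A' \<noteq> {}" "B' \<noteq> {}"
    using t card1 by auto
  have H: "is_subgroup H" "C + H = C"
    by (simp_all add: H_def is_subgroup_stabilizer plus_stabilizer)
  have finH: "finite H"
    unfolding H_def C_eq[symmetric] using fin' ne'
    by (simp add: finite_stabilizer finite_set_plus set_plus_eq_empty_iff)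
  have card_plus_H: "card X \<le> card (X + H)" if "finite X" for X
    using that finH is_subgroupD(1)[OF H(1)] by (intro card_le_card_set_plus) auto
  define d l where "d = card (D - C)" and "l = card (A - A') + card (B - B')"
  have "t * card D + 2 * t\<^sup>2 \<le> t * (card A1 + card B1)"
    using df1 by (simp add: deficient_def)
  also have "\<dots> \<le> t * (card A' + card B')"
    using card1' by (intro mult_le_mono2) simp
  finally have holes: "card (A' + H) + card (B' + H) + d + 2 * t \<le> card A' + card B' + card H"
    using kneser_holes[OF fin' finD ne' _ t, of H] CD by (simp add: C_eq d_def H_def)
  \<comment> \<open>Once \<open>d = 0\<close> is known, \<open>z\<close> is |H| - \<rho>. By
    \<open>holes\<close> the subtraction is not truncated.\<close>
  define z where "z = card A' + card B' + card H - (card (A' + H) + card (B' + H) + d)"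
  have z: "card (A' + H) + card (B' + H) + d + z = card A' + card B' + card H" "2 * t \<le> z"
    using holes by (auto simp: z_def)
  \<comment> \<open>Each deleted element accounts for \<open>z\<close> missed pairs by
    \<open>coset_outside\<close>. The two families are disjoint, their first entries being outside
    and inside \<open>A'\<close>.\<close>
  have "z * l \<le> card (missed D A B)"
  proof -
    have 1: "z \<le> card {b\<in>B'. a + b \<notin> D}" if "a \<in> A - A'" for a
    proof -
      obtain b where "b \<in> B'" "a + b \<notin> C"
        using \<open>a \<in> A - A'\<close> sub1' by (auto simp: A'_def)
      from coset_outside[OF H(1) finH H(2) fin'(2) finD this] show ?thesis
        using z card_plus_H[OF fin'(1)] by (simp add: d_def)
    qed
    have 2: "z \<le> card {a\<in>A'. a + b \<notin> D}" if "b \<in> B - B'" for b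
    proof -
      obtain a where "a \<in> A'" "b + a \<notin> C"
        using \<open>b \<in> B - B'\<close> by (auto simp: B'_def add.commute)
      from coset_outside[OF H(1) finH H(2) fin'(1) finD this] show ?thesis
        using z card_plus_H[OF fin'(2)] by (simp add: d_def add.commute[of b])
    qed
    have "card (A - A') * z \<le> card (missed D (A - A') B')"
      using sum_mono[of "A - A'" "\<lambda>_. z"] 1 fin fin' by (simp add: card_missed_rows)
    moreover have "card (B - B') * z \<le> card (missed D A' (B - B'))"
      using sum_mono[of "B - B'" "\<lambda>_. z"] 2 fin fin' by (simp add: card_missed_cols)
    moreover have "card (missed D (A - A') B') + card (missed D A' (B - B'))
        = card (missed D (A - A') B' \<union> missed D A' (B - B'))"
      using fin fin' by (intro card_Un_disjoint[symmetric] finite_missed) (auto simp: missed_def)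
    moreover have "\<dots> \<le> card (missed D A B)"
      using fin sub' by (intro card_mono finite_missed) (auto simp: missed_def)
    ultimately show ?thesis
      by (simp add: l_def algebra_simps)
  qed
  then have missed_ge: "int z * int l \<le> int (card (missed D A B))"
    by (simp flip: of_nat_mult)
  have "card D = card C + d"
    unfolding d_def using CD finD by (metis card_Diff_subset card_mono finite_subset le_add_diff_inverse)
  moreover have "card A' + card B' \<le> card C + d + z"
    using kneser[OF fin' ne', of H] z(1) by (simp add: C_eq H_def)
  moreover have "card A' = card A - card (A - A')" "card B' = card B - card (B - B')"
    using sub' fin fin' by (simp_all add: card_Diff_subset card_mono)
  moreover have "card (A - A') \<le> card A" "card (B - B') \<le> card B"
    using fin by (auto intro: card_mono)
  ultimately have D_ge: "int (card A) + int (card B) \<le> int (card D) + int l + int z"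
    unfolding l_def by linarith
  then have "int t * (int (card A) + int (card B)) \<le> int t * (int (card D) + int l + int z)"
    by (intro mult_left_mono) auto
  \<comment> \<open>Already the required lower bound for the sum, with \<open>z\<close> in place of
    |H| - \<rho>.\<close>
  then have main: "int t * int (card A) + int t * int (card B) - (int t - int l) * int z - int t * int l
      \<le> int t * int (card D) + int (card (missed D A B))"
    using missed_ge by (simp add: algebra_simps)
  \<comment> \<open>If \<open>l \<ge> t\<close>, replacing \<open>z\<close> by \<open>2 * t\<close>
    in \<open>main\<close> and comparing with \<open>S_less\<close> leaves t l \<le> 0.\<close>
  have l: "l < t"
  proof (rule ccontr)
    assume "\<not> l < t"
    then have "(int l - int t) * (2 * int t) \<le> (int l - int t) * int z"
      using z(2) by (intro mult_left_mono) auto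
    moreover have "int t * int l > 0"
      using t \<open>\<not> l < t\<close> by simp
    ultimately show False
      using main S_less by (simp add: algebra_simps power2_eq_square)
  qed
  \<comment> \<open>At most \<open>l < t\<close> representations of a popular sum use an element
    outside \<open>A'\<close> or \<open>B'\<close>, so one remains inside.\<close>
  have DC: "D = C"
  proof (rule antisym[OF _ CD])
    show "D \<subseteq> C"
    proof (rule subsetI, rule ccontr)
      fix g assume g: "g \<in> D" "g \<notin> C"
      have "rep_count A B g \<le> card ((A - A') \<union> {a\<in>A'. g - a \<in> B})"
        unfolding rep_count_eq using fin fin' by (intro card_mono) auto
      also have "\<dots> \<le> card (A - A') + card {a\<in>A'. g - a \<in> B}"
        by (rule card_Un_le)
      also have "card {a\<in>A'. g - a \<in> B} \<le> card (B - B')"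
      proof (rule card_inj_on_le[where f = "\<lambda>a. g - a"])
        show "(\<lambda>a. g - a) ` {a\<in>A'. g - a \<in> B} \<subseteq> B - B'"
        proof clarify
          fix a assume "a \<in> A'" "g - a \<in> B'"
          then have "a + (g - a) \<in> C"
            unfolding C_eq[symmetric] by (rule set_plus_intro)
          then show False
            using g by simp
        qed
      qed (use fin in \<open>auto simp: inj_on_def\<close>)
      finally show False
        using rep[of g] g l by (simp add: l_def)
    qed
  qed
  then have "d = 0"
    by (simp add: d_def)
  have "z \<le> card H"
    using z(1) card_plus_H[OF fin'(1)] card_plus_H[OF fin'(2)] by simp
  \<comment> \<open>With \<open>d = 0\<close>, the slices of \<open>A'\<close> and \<open>B'\<close>
    on the cosets of \<open>a\<close> and \<open>b\<close> have at least |H| + z elements together,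
    so each sum has \<open>z \<ge> 2 * t\<close> representations.\<close>
  have popular: "A' +[t] B' = A' + B'"
  proof -
    have "t \<le> rep_count A' B' g" if "g \<in> A' + B'" for g
    proof -
      obtain a b where ab: "a \<in> A'" "b \<in> B'" "g = a + b"
        using \<open>g \<in> A' + B'\<close> by (rule set_plus_elim)
      have "card (A' \<inter> (a +o H)) + card (B' \<inter> (b +o H)) \<le> card H + rep_count (A' \<inter> (a +o H)) (B' \<inter> (b +o H)) g"
        by (rule rep_count_coset[OF H(1) finH, of _ a _ b]) (auto simp: ab self_mem_coset[OF H(1)])
      also have "rep_count (A' \<inter> (a +o H)) (B' \<inter> (b +o H)) g \<le> rep_count A' B' g"
        using fin' by (intro rep_count_mono) auto
      finally show ?thesis
        using coset_holes[OF fin'(1) finH H(1) ab(1)] coset_holes[OF fin'(2) finH H(1) ab(2)]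
          z \<open>d = 0\<close> by simp
    qed
    then show ?thesis
      using t by (auto simp: popular_sumset_eq)
  qed
  \<comment> \<open>Here |H| \<ge> z \<ge> 2 t \<ge> 2.\<close>
  have "H \<noteq> {0}"
    using \<open>z \<le> card H\<close> z(2) t by auto
  have \<rho>: "int (card H) - (int (card (A' + H)) - int (card A') + int (card (B' + H)) - int (card B')) = int z"
    using z(1) \<open>d = 0\<close> by linarith
  have last: "(int t - int l) * int z + int t * int l \<le> int t * int (card H)"
  proof -
    have "(int t - int l) * int z \<le> (int t - int l) * int (card H)"
      using l \<open>z \<le> card H\<close> by (intro mult_left_mono) auto
    moreover have "int l * int t \<le> int l * int (card H)"
      using z(2) \<open>z \<le> card H\<close> by (intro mult_left_mono) auto
    ultimately show ?thesis
      by (simp add: algebra_simps)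
  qed
  have l_eq: "int (card (A - A')) + int (card (B - B')) = int l"
    by (simp add: l_def)
  have H_eq: "stabilizer (A +[t] B) = H"
    using DC by (simp add: H_def D_def)
  show "\<exists>A' B'. A' \<subseteq> A \<and> B' \<subseteq> B \<and>
            (let l = int (card (A - A')) + int (card (B - B'));
                 H = stabilizer (A +[t] B);
                 \<rho> = int (card (A' + H)) - int (card A') + int (card (B' + H)) - int (card B')
             in H \<noteq> {0} \<and>
                l \<le> int t - 1 \<and>
                A' +[t] B' = A' + B' \<and> A' + B' = A +[t] B \<and>
                (\<Sum>i=1..t. int (card (A +[i] B)))
                  \<ge> int t * int (card A) + int t * int (card B)
                      - (int t - l) * (int (card H) - \<rho>) - int t * l \<and>
                int t * int (card A) + int t * int (card B)
                      - (int t - l) * (int (card H) - \<rho>) - int t * l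
                  \<ge> int t * int (card A) + int t * int (card B) - int t * int (card H))"
  proof (rule exI[of _ A'], rule exI[of _ B'], unfold Let_def H_eq l_eq \<rho> S, intro conjI)
    show "A' + B' = A +[t] B"
      using C_eq DC by (simp add: D_def)
    show "int t * int (card A) + int t * int (card B) - int t * int (card H)
        \<le> int t * int (card A) + int t * int (card B) - (int t - int l) * int z - int t * int l"
      using last by linarith
  qed (use sub' \<open>H \<noteq> {0}\<close> l popular main in auto)
qed

end
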